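(* Let $\Omega$ be a finite set of size $D\ge2$, let $k$ be an integer with $1\le k\le D-1$, and let $x_0\in\binom\Omega k$. Then $\mathbf T(x_0)$ equals the image of the representation $\mathcal H\to\mathrm{End}(\mathbb C^{\binom\Omega k})$ corresponding to the $\mathcal H$-module $\mathbb C^{\binom\Omega k}(x_0)$.
   Context: All algebras are unital associative over $\mathbb C$. $U(\mathfrak{sl}_2)$ is generated by $E,F,H$ with $[H,E]=2E$, $[H,F]=-2F$, $[E,F]=H$; $\Lambda=EF+FE+\frac{H^2}{2}$; $\Delta$ is the algebra homomorphism $U(\mathfrak{sl}_2)\to U(\mathfrak{sl}_2)^{\otimes2}$, $\Delta(X)=X\otimes1+1\otimes X$ ($X=E,F,H$). The universal Hahn algebra $\mathcal H$ is generated by $A,B,C$ with $[A,B]=C$ and each of $[C,A]+2A^2+B$, $[B,C]+4BA+2C$ central. $\natural:\mathcal H\to U(\mathfrak{sl}_2)^{\otimes 2}$ is the algebra homomorphism $A\mapsto\frac{H\otimes1-1\otimes H}{4}$, $B\mapsto\frac{\Delta(\Lambda)}2$, $C\mapsto E\otimes F-F\otimes E$; $U(\mathfrak{sl}_2)^{\otimes2}$-modules are $\mathcal H$-modules via $\natural$. For a finite set $S$, $\mathbb C^{2^S}$ has basis $2^S$ and is a $U(\mathfrak{sl}_2)$-module via $Ex=\sum_{y\subseteq x,|y|=|x|-1}y$, $Fx=\sum_{y\supseteq x,|y|=|x|+1}y$, $Hx=(|S|-2|x|)x$. Via the linear isomorphism $\iota(x_0):\mathbb C^{2^\Omega}\to\mathbb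 C^{2^{\Omega\setminus x_0}}\otimes\mathbb C^{2^{x_0}}$, $x\mapsto(x\setminus x_0)\otimes(x\cap x_0)$, $\mathbb C^{2^\Omega}$ becomes a $U(\mathfrak{sl}_2)^{\otimes2}$-module, hence an $\mathcal H$-module. $\binom\Omega k$ is the set of $k$-subsets of $\Omega$; its span $\mathbb C^{\binom\Omega k}$ is the subspace on which $\Delta(H)$ acts as $D-2k$, hence an $\mathcal H$-submodule, denoted $\mathbb C^{\binom\Omega k}(x_0)$. The Johnson graph $J(D,k)$ has vertex set $\binom\Omega k$, with $x,y$ adjacent iff $|x\cap y|=k-1$. Its adjacency operator $\mathbf A\in\mathrm{End}(\mathbb C^{\binom\Omega k})$ is $\mathbf Ax=\sum_{y\in\binom\Omega k,\,|x\cap y|=k-1}y$, and the dual adjacency operator with respect to $x_0$ is $\mathbf A^*(x_0)x=(D-1)\left(1-\frac{D(|x_0\setminus x|+|x\setminus x_0|)}{2k(D-k)}\right)x$. The Terwilliger algebra $\mathbf T(x_0)$ is the subalgebra of $\mathrm{End}(\mathbb C^{\binom\Omega k})$ generated by $\mathbf A$ and $\mathbf A^*(x_0)$. *)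

theory Defs
  imports Complex_Main "HOL-Library.Poly_Mapping" "HOL-Library.FuncSet" "HOL-Library.Ramsey"
begin

section \<open>Complex vector spaces and unital associative algebras\<close>

class complex_vector = ab_group_add +
  fixes scaleC :: "complex \<Rightarrow> 'a \<Rightarrow> 'a" (infixr \<open>*\<^sub>C\<close> 75)
  assumes scaleC_add_right: "c *\<^sub>C (x + y) = c *\<^sub>C x + c *\<^sub>C y"
    and scaleC_add_left: "(c + d) *\<^sub>C x = c *\<^sub>C x + d *\<^sub>C x"
    and scaleC_scaleC [simp]: "c *\<^sub>C d *\<^sub>C x = (c * d) *\<^sub>C x"
    and scaleC_one [simp]: "1 *\<^sub>C x = x"

text \<open>The zero algebra is allowed, hence no \<^class>\<open>zero_neq_one\<close>.\<close>

class complex_algebra_1 = complex_vector + ring + monoid_mult +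
  assumes mult_scaleC_left [simp]: "(c *\<^sub>C x) * y = c *\<^sub>C (x * y)"
    and mult_scaleC_right [simp]: "x * (c *\<^sub>C y) = c *\<^sub>C (x * y)"

global_interpretation complex_vector: vector_space "scaleC :: complex \<Rightarrow> 'a \<Rightarrow> 'a::complex_vector"
  by unfold_locales (simp_all add: scaleC_add_right scaleC_add_left)

abbreviation clinear :: "('a::complex_vector \<Rightarrow> 'b::complex_vector) \<Rightarrow> bool"
  where "clinear \<equiv> Vector_Spaces.linear scaleC scaleC"

lemma clinear_iff:
  "clinear f \<longleftrightarrow> (\<forall>x y. f (x + y) = f x + f y) \<and> (\<forall>c x. f (c *\<^sub>C x) = c *\<^sub>C f x)"
  unfolding Vector_Spaces.linear_iff by (simp add: complex_vector.vector_space_axioms)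

definition cbilinear :: "('a::complex_vector \<Rightarrow> 'b::complex_vector \<Rightarrow> 'c::complex_vector) \<Rightarrow> bool"
  where "cbilinear f \<longleftrightarrow> (\<forall>a. clinear (f a)) \<and> (\<forall>b. clinear (\<lambda>a. f a b))"

lemmas scaleC_zero_left [simp] = complex_vector.scale_zero_left
lemmas scaleC_zero_right [simp] = complex_vector.scale_zero_right
lemmas scaleC_minus_left = complex_vector.scale_minus_left
lemmas scaleC_minus_right = complex_vector.scale_minus_right
lemmas scaleC_diff_left = complex_vector.scale_left_diff_distrib
lemmas scaleC_diff_right = complex_vector.scale_right_diff_distrib

lemma clinear_add: "clinear f \<Longrightarrow> f (x + y) = f x + f y"
  and clinear_scaleC: "clinear f \<Longrightarrow> f (c *\<^sub>C x) = c *\<^sub>C f x"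
  by (simp_all add: clinear_iff)

lemma clinear_zero: "clinear f \<Longrightarrow> f 0 = 0"
  using clinear_scaleC[of f 0 0] by simp

lemma clinear_minus: "clinear f \<Longrightarrow> f (- x) = - f x"
  using clinear_scaleC[of f "-1" x] by (simp add: scaleC_minus_left)

lemma clinear_diff: "clinear f \<Longrightarrow> f (x - y) = f x - f y"
  by (metis clinear_add clinear_minus uminus_add_conv_diff add.commute)

definition algebra_hom :: "('a::complex_algebra_1 \<Rightarrow> 'b::complex_algebra_1) \<Rightarrow> bool"
  where "algebra_hom f \<longleftrightarrow> clinear f \<and> f 1 = 1 \<and> (\<forall>x y. f (x * y) = f x * f y)"

instantiation complex :: complex_algebra_1
begin
definition "scaleC_complex = ((*) :: complex \<Rightarrow> _)"
instance by standard (simp_all add: scaleC_complex_def algebra_simps)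
end

section \<open>Free vector spaces\<close>

text \<open>The free vector space on \<open>'x\<close> is the type of finitely supported functions; the basis
  vector of \<open>x\<close> is \<^term>\<open>Poly_Mapping.single x 1\<close>.\<close>

type_synonym 'x free_vec = "'x \<Rightarrow>\<^sub>0 complex"

abbreviation basis_vec :: "'x \<Rightarrow> 'x free_vec"
  where "basis_vec x \<equiv> Poly_Mapping.single x 1"

instantiation poly_mapping :: (type, complex_vector) complex_vector
begin
lift_definition scaleC_poly_mapping :: "complex \<Rightarrow> ('a \<Rightarrow>\<^sub>0 'b) \<Rightarrow> ('a \<Rightarrow>\<^sub>0 'b)"
  is "\<lambda>c f x. c *\<^sub>C f x"
  by (erule finite_subset[rotated]) auto
instance
  by standard (transfer; simp add: scaleC_add_right scaleC_add_left fun_eq_iff)+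
end

lemma lookup_scaleC [simp]: "Poly_Mapping.lookup (c *\<^sub>C v) x = c *\<^sub>C Poly_Mapping.lookup v x"
  by transfer simp

definition linear_extension :: "('x \<Rightarrow> 'v::complex_vector) \<Rightarrow> 'x free_vec \<Rightarrow> 'v"
  where "linear_extension f v = (\<Sum>x\<in>Poly_Mapping.keys v. Poly_Mapping.lookup v x *\<^sub>C f x)"

lemma linear_extension_superset:
  assumes "finite A" "Poly_Mapping.keys v \<subseteq> A"
  shows "linear_extension f v = (\<Sum>x\<in>A. Poly_Mapping.lookup v x *\<^sub>C f x)"
  unfolding linear_extension_def using assms
  by (intro sum.mono_neutral_left) (auto simp: in_keys_iff)

lemma linear_extension_basis [simp]: "linear_extension f (basis_vec x) = f x"
  by (simp add: linear_extension_def)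

lemma clinear_linear_extension: "clinear (linear_extension f)"
proof -
  have 1: "linear_extension f (v + w) = linear_extension f v + linear_extension f w" for v w
  proof -
    let ?A = "Poly_Mapping.keys v \<union> Poly_Mapping.keys w"
    have "Poly_Mapping.keys (v + w) \<subseteq> ?A" by (rule Poly_Mapping.keys_add)
    then show ?thesis
      by (simp add: linear_extension_superset[of ?A] lookup_add scaleC_add_left sum.distrib)
  qed
  have 2: "linear_extension f (c *\<^sub>C v) = c *\<^sub>C linear_extension f v" for c v
  proof -
    let ?A = "Poly_Mapping.keys v"
    have "Poly_Mapping.keys (c *\<^sub>C v) \<subseteq> ?A"
      by (auto simp: in_keys_iff)
    then show ?thesis
      by (simp add: linear_extension_superset[of ?A] complex_vector.scale_sum_right
        scaleC_complex_def)
  qed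
  show ?thesis unfolding clinear_iff using 1 2 by blast
qed

lemma free_vec_expansion: "v = linear_extension basis_vec v"
proof (rule poly_mapping_eqI)
  fix k
  have *: "Poly_Mapping.lookup v x * Poly_Mapping.lookup (basis_vec x) k
      = (if k = x then Poly_Mapping.lookup v x else 0)" for x
    by (simp add: lookup_single when_def)
  show "Poly_Mapping.lookup v k = Poly_Mapping.lookup (linear_extension basis_vec v) k"
    by (simp add: linear_extension_def lookup_sum scaleC_complex_def * sum.delta in_keys_iff)
qed

lemma free_vec_induct [case_names zero add]:
  assumes "P 0" "\<And>v c x. P v \<Longrightarrow> P (v + c *\<^sub>C basis_vec x)"
  shows "P (v :: 'x free_vec)"
proof -
  have *: "P (\<Sum>x\<in>A. Poly_Mapping.lookup v x *\<^sub>C basis_vec x)" if "finite A" for A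
    using that
  proof induction
    case empty
    show ?case using assms(1) by simp
  next
    case (insert x A)
    have "P ((\<Sum>x\<in>A. Poly_Mapping.lookup v x *\<^sub>C basis_vec x) + Poly_Mapping.lookup v x *\<^sub>C basis_vec x)"
      by (rule assms(2)[OF insert.IH])
    then show ?case using insert.hyps by (simp add: add.commute)
  qed
  have "P (linear_extension basis_vec v)"
    unfolding linear_extension_def by (rule *) (rule finite_keys)
  then show ?thesis using free_vec_expansion[of v] by metis
qed

section \<open>Endomorphism algebras\<close>

typedef (overloaded) 'v cendo = "{f :: 'v::complex_vector \<Rightarrow> 'v. clinear f}"
  morphisms cendo_apply Abs_cendo
  by (rule exI[of _ id]) (simp add: clinear_iff)

setup_lifting type_definition_cendo

instantiation cendo :: (complex_vector) complex_algebra_1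
begin
lift_definition zero_cendo :: "'a cendo" is "\<lambda>_. 0" by (simp add: clinear_iff)
lift_definition one_cendo :: "'a cendo" is "\<lambda>x. x" by (simp add: clinear_iff)
lift_definition plus_cendo :: "'a cendo \<Rightarrow> 'a cendo \<Rightarrow> 'a cendo" is "\<lambda>f g x. f x + g x"
  by (simp add: clinear_iff scaleC_add_right algebra_simps)
lift_definition minus_cendo :: "'a cendo \<Rightarrow> 'a cendo \<Rightarrow> 'a cendo" is "\<lambda>f g x. f x - g x"
  by (simp add: clinear_iff scaleC_diff_right algebra_simps)
lift_definition uminus_cendo :: "'a cendo \<Rightarrow> 'a cendo" is "\<lambda>f x. - f x"
  by (simp add: clinear_iff scaleC_minus_right)
lift_definition times_cendo :: "'a cendo \<Rightarrow> 'a cendo \<Rightarrow> 'a cendo" is "\<lambda>f g x. f (g x)"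
  by (simp add: clinear_iff)
lift_definition scaleC_cendo :: "complex \<Rightarrow> 'a cendo \<Rightarrow> 'a cendo" is "\<lambda>c f x. c *\<^sub>C f x"
  by (simp add: clinear_iff scaleC_add_right mult.commute)
instance
proof
  fix f g h :: "'a cendo" and c d :: complex
  show "f + g + h = f + (g + h)" by transfer (simp add: add.assoc)
  show "f + g = g + f" by transfer (simp add: add.commute)
  show "0 + f = f" by transfer simp
  show "- f + f = 0" by transfer simp
  show "f - g = f + - g" by transfer simp
  show "f * g * h = f * (g * h)" by transfer simp
  show "1 * f = f" by transfer simp
  show "f * 1 = f" by transfer simp
  show "(f + g) * h = f * h + g * h" by transfer simp
  show "f * (g + h) = f * g + f * h" by transfer (simp add: clinear_add)
  show "c *\<^sub>C (f + g) = c *\<^sub>C f + c *\<^sub>C g" by transfer (simp add: scaleC_add_right)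
  show "(c + d) *\<^sub>C f = c *\<^sub>C f + d *\<^sub>C f" by transfer (simp add: scaleC_add_left)
  show "c *\<^sub>C d *\<^sub>C f = (c * d) *\<^sub>C f" by transfer simp
  show "1 *\<^sub>C f = f" by transfer simp
  show "(c *\<^sub>C f) * g = c *\<^sub>C (f * g)" by transfer simp
  show "f * (c *\<^sub>C g) = c *\<^sub>C (f * g)" by transfer (simp add: clinear_scaleC)
qed
end

definition linear_extension_endo :: "('x \<Rightarrow> 'x free_vec) \<Rightarrow> 'x free_vec cendo"
  where "linear_extension_endo f = Abs_cendo (linear_extension f)"

lemma cendo_apply_linear_extension_endo [simp]:
  "cendo_apply (linear_extension_endo f) = linear_extension f"
  by (simp add: linear_extension_endo_def Abs_cendo_inverse clinear_linear_extension)

section \<open>Algebras given by generators and relations\<close>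

datatype 'g alg_term =
    Gen 'g
  | Scal complex
  | Plus "'g alg_term" "'g alg_term" (infixl \<open>\<oplus>\<^sub>t\<close> 65)
  | Times "'g alg_term" "'g alg_term" (infixl \<open>\<otimes>\<^sub>t\<close> 70)

abbreviation tminus :: "'g alg_term \<Rightarrow> 'g alg_term \<Rightarrow> 'g alg_term" (infixl \<open>\<ominus>\<^sub>t\<close> 65)
  where "s \<ominus>\<^sub>t t \<equiv> s \<oplus>\<^sub>t Scal (-1) \<otimes>\<^sub>t t"

abbreviation tcomm :: "'g alg_term \<Rightarrow> 'g alg_term \<Rightarrow> 'g alg_term"
  where "tcomm s t \<equiv> s \<otimes>\<^sub>t t \<ominus>\<^sub>t t \<otimes>\<^sub>t s"

inductive alg_cong :: "('g alg_term \<Rightarrow> 'g alg_term \<Rightarrow> bool) \<Rightarrow> 'g alg_term \<Rightarrow> 'g alg_term \<Rightarrow> bool"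
  for R where
  ac_rel: "R s t \<Longrightarrow> alg_cong R s t"
| ac_refl: "alg_cong R s s"
| ac_sym: "alg_cong R s t \<Longrightarrow> alg_cong R t s"
| ac_trans: "alg_cong R s t \<Longrightarrow> alg_cong R t u \<Longrightarrow> alg_cong R s u"
| ac_cong_plus: "alg_cong R s s' \<Longrightarrow> alg_cong R t t' \<Longrightarrow> alg_cong R (s \<oplus>\<^sub>t t) (s' \<oplus>\<^sub>t t')"
| ac_cong_times: "alg_cong R s s' \<Longrightarrow> alg_cong R t t' \<Longrightarrow> alg_cong R (s \<otimes>\<^sub>t t) (s' \<otimes>\<^sub>t t')"
| ac_plus_assoc: "alg_cong R (s \<oplus>\<^sub>t t \<oplus>\<^sub>t u) (s \<oplus>\<^sub>t (t \<oplus>\<^sub>t u))"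
| ac_plus_commute: "alg_cong R (s \<oplus>\<^sub>t t) (t \<oplus>\<^sub>t s)"
| ac_plus_zero: "alg_cong R (Scal 0 \<oplus>\<^sub>t s) s"
| ac_plus_minus: "alg_cong R (s \<ominus>\<^sub>t s) (Scal 0)"
| ac_times_assoc: "alg_cong R (s \<otimes>\<^sub>t t \<otimes>\<^sub>t u) (s \<otimes>\<^sub>t (t \<otimes>\<^sub>t u))"
| ac_times_one: "alg_cong R (Scal 1 \<otimes>\<^sub>t s) s"
| ac_distrib_left: "alg_cong R (s \<otimes>\<^sub>t (t \<oplus>\<^sub>t u)) (s \<otimes>\<^sub>t t \<oplus>\<^sub>t s \<otimes>\<^sub>t u)"
| ac_distrib_right: "alg_cong R ((s \<oplus>\<^sub>t t) \<otimes>\<^sub>t u) (s \<otimes>\<^sub>t u \<oplus>\<^sub>t t \<otimes>\<^sub>t u)"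
| ac_scal_plus: "alg_cong R (Scal (c + d)) (Scal c \<oplus>\<^sub>t Scal d)"
| ac_scal_times: "alg_cong R (Scal (c * d)) (Scal c \<otimes>\<^sub>t Scal d)"
| ac_scal_commute: "alg_cong R (Scal c \<otimes>\<^sub>t s) (s \<otimes>\<^sub>t Scal c)"

text \<open>A presentation is a type of generators carrying a set of relations, so that the presented
  algebra \<open>'g presented\<close> is determined by the generator type.\<close>

class presentation =
  fixes relation :: "'a alg_term \<Rightarrow> 'a alg_term \<Rightarrow> bool"

quotient_type (overloaded) 'g presented = "'g::presentation alg_term" / "alg_cong relation"
  by (rule equivpI) (auto intro!: reflpI sympI transpI alg_cong.ac_refl intro: alg_cong.ac_sym alg_cong.ac_trans)

instantiation presented :: (presentation) complex_algebra_1
begin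
lift_definition zero_presented :: "'a presented" is "Scal 0" .
lift_definition one_presented :: "'a presented" is "Scal 1" .
lift_definition plus_presented :: "'a presented \<Rightarrow> 'a presented \<Rightarrow> 'a presented" is Plus
  by (rule alg_cong.ac_cong_plus)
lift_definition times_presented :: "'a presented \<Rightarrow> 'a presented \<Rightarrow> 'a presented" is Times
  by (rule alg_cong.ac_cong_times)
lift_definition scaleC_presented :: "complex \<Rightarrow> 'a presented \<Rightarrow> 'a presented"
  is "\<lambda>c t. Scal c \<otimes>\<^sub>t t"
  by (rule alg_cong.ac_cong_times[OF alg_cong.ac_refl])
lift_definition uminus_presented :: "'a presented \<Rightarrow> 'a presented" is "\<lambda>t. Scal (-1) \<otimes>\<^sub>t t"
  by (rule alg_cong.ac_cong_times[OF alg_cong.ac_refl])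
lift_definition minus_presented :: "'a presented \<Rightarrow> 'a presented \<Rightarrow> 'a presented" is tminus
  by (intro alg_cong.ac_cong_plus alg_cong.ac_cong_times alg_cong.ac_refl)
instance
proof
  fix a b c :: "'a presented" and x y :: complex
  show "a + b + c = a + (b + c)" by transfer (rule alg_cong.ac_plus_assoc)
  show "a + b = b + a" by transfer (rule alg_cong.ac_plus_commute)
  show "0 + a = a" by transfer (rule alg_cong.ac_plus_zero)
  show "- a + a = 0"
    by transfer (rule alg_cong.ac_trans[OF alg_cong.ac_plus_commute alg_cong.ac_plus_minus])
  show "a - b = a + - b" by transfer (rule alg_cong.ac_refl)
  show "a * b * c = a * (b * c)" by transfer (rule alg_cong.ac_times_assoc)
  show "1 * a = a" by transfer (rule alg_cong.ac_times_one)
  show "a * 1 = a"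
    by transfer (rule alg_cong.ac_trans[OF alg_cong.ac_sym[OF alg_cong.ac_scal_commute] alg_cong.ac_times_one])
  show "(a + b) * c = a * c + b * c" by transfer (rule alg_cong.ac_distrib_right)
  show "a * (b + c) = a * b + a * c" by transfer (rule alg_cong.ac_distrib_left)
  show "x *\<^sub>C (a + b) = x *\<^sub>C a + x *\<^sub>C b" by transfer (rule alg_cong.ac_distrib_left)
  show "(x + y) *\<^sub>C a = x *\<^sub>C a + y *\<^sub>C a"
    by transfer (rule alg_cong.ac_trans[OF alg_cong.ac_cong_times[OF alg_cong.ac_scal_plus alg_cong.ac_refl]
        alg_cong.ac_distrib_right])
  show "x *\<^sub>C y *\<^sub>C a = (x * y) *\<^sub>C a"
    by transfer (rule alg_cong.ac_sym, rule alg_cong.ac_trans[OF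
        alg_cong.ac_cong_times[OF alg_cong.ac_scal_times alg_cong.ac_refl] alg_cong.ac_times_assoc])
  show "1 *\<^sub>C a = a" by transfer (rule alg_cong.ac_times_one)
  show "(x *\<^sub>C a) * b = x *\<^sub>C (a * b)" by transfer (rule alg_cong.ac_times_assoc)
  show "a * (x *\<^sub>C b) = x *\<^sub>C (a * b)"
  proof transfer
    fix a b :: "'a alg_term" and x
    have "alg_cong relation (a \<otimes>\<^sub>t (Scal x \<otimes>\<^sub>t b)) (a \<otimes>\<^sub>t Scal x \<otimes>\<^sub>t b)"
      by (rule alg_cong.ac_sym[OF alg_cong.ac_times_assoc])
    moreover have "alg_cong relation (a \<otimes>\<^sub>t Scal x \<otimes>\<^sub>t b) (Scal x \<otimes>\<^sub>t a \<otimes>\<^sub>t b)"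
      by (rule alg_cong.ac_cong_times[OF alg_cong.ac_sym[OF alg_cong.ac_scal_commute] alg_cong.ac_refl])
    moreover have "alg_cong relation (Scal x \<otimes>\<^sub>t a \<otimes>\<^sub>t b) (Scal x \<otimes>\<^sub>t (a \<otimes>\<^sub>t b))"
      by (rule alg_cong.ac_times_assoc)
    ultimately show "alg_cong relation (a \<otimes>\<^sub>t (Scal x \<otimes>\<^sub>t b)) (Scal x \<otimes>\<^sub>t (a \<otimes>\<^sub>t b))"
      by (blast intro: alg_cong.ac_trans)
  qed
qed
end

lift_definition generator :: "'g::presentation \<Rightarrow> 'g presented" is Gen .

primrec eval_term :: "('g \<Rightarrow> 'b::complex_algebra_1) \<Rightarrow> 'g alg_term \<Rightarrow> 'b" where
  "eval_term \<phi> (Gen g) = \<phi> g"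
| "eval_term \<phi> (Scal c) = c *\<^sub>C 1"
| "eval_term \<phi> (s \<oplus>\<^sub>t t) = eval_term \<phi> s + eval_term \<phi> t"
| "eval_term \<phi> (s \<otimes>\<^sub>t t) = eval_term \<phi> s * eval_term \<phi> t"

text \<open>The algebra homomorphism with prescribed values on the generators. It does not depend on
  the chosen representatives as soon as these values satisfy the relations, see
  \<open>algebra_hom_presented_hom\<close> below.\<close>

definition presented_hom :: "('g::presentation \<Rightarrow> 'b::complex_algebra_1) \<Rightarrow> 'g presented \<Rightarrow> 'b"
  where "presented_hom \<phi> u = eval_term \<phi> (rep_presented u)"

definition respects_relations :: "('g::presentation \<Rightarrow> 'b::complex_algebra_1) \<Rightarrow> bool"
  where "respects_relations \<phi> \<longleftrightarrow> (\<forall>s t. relation s t \<longrightarrow> eval_term \<phi> s = eval_term \<phi> t)"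

lemma eval_term_cong:
  assumes "respects_relations \<phi>" "alg_cong relation s t"
  shows "eval_term \<phi> s = eval_term \<phi> t"
  using assms(2)
proof induction
  case (ac_rel s t)
  then show ?case using assms(1) unfolding respects_relations_def by blast
qed (simp_all add: ring_distribs add.assoc add.commute mult.assoc scaleC_add_left
    scaleC_minus_left)

lemma presented_hom_abs:
  assumes "respects_relations \<phi>"
  shows "presented_hom \<phi> (abs_presented t) = eval_term \<phi> t"
  unfolding presented_hom_def
  by (rule eval_term_cong[OF assms]) (rule Quotient3_rep_abs[OF Quotient3_presented alg_cong.ac_refl])

lemma presented_hom_generator:
  assumes "respects_relations \<phi>"
  shows "presented_hom \<phi> (generator g) = \<phi> g"
  unfolding generator.abs_eq by (simp add: presented_hom_abs assms)

lemma algebra_hom_presented_hom: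
  assumes "respects_relations \<phi>"
  shows "algebra_hom (presented_hom \<phi>)"
proof -
  note [simp] = presented_hom_abs[OF assms]
  have "presented_hom \<phi> (x + y) = presented_hom \<phi> x + presented_hom \<phi> y" for x y
    by (induction x rule: presented.abs_induct; induction y rule: presented.abs_induct)
      (simp add: plus_presented.abs_eq)
  moreover have "presented_hom \<phi> (x * y) = presented_hom \<phi> x * presented_hom \<phi> y" for x y
    by (induction x rule: presented.abs_induct; induction y rule: presented.abs_induct)
      (simp add: times_presented.abs_eq)
  moreover have "presented_hom \<phi> (c *\<^sub>C x) = c *\<^sub>C presented_hom \<phi> x" for c x
    by (induction x rule: presented.abs_induct) (simp add: scaleC_presented.abs_eq)
  moreover have "presented_hom \<phi> 1 = 1"
    by (simp add: one_presented.abs_eq)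
  ultimately show ?thesis
    by (simp add: algebra_hom_def clinear_iff)
qed

section \<open>Tensor products\<close>

definition tensor_relators :: "('a::complex_vector \<times> 'b::complex_vector) free_vec set" where
  "tensor_relators =
     {basis_vec (a + a', b) - basis_vec (a, b) - basis_vec (a', b) | a a' b. True} \<union>
     {basis_vec (a, b + b') - basis_vec (a, b) - basis_vec (a, b') | a b b'. True} \<union>
     {basis_vec (c *\<^sub>C a, b) - c *\<^sub>C basis_vec (a, b) | c a b. True} \<union>
     {basis_vec (a, c *\<^sub>C b) - c *\<^sub>C basis_vec (a, b) | c a b. True}"

definition tensor_cong ::
  "('a::complex_vector \<times> 'b::complex_vector) free_vec \<Rightarrow> ('a \<times> 'b) free_vec \<Rightarrow> bool"
  where "tensor_cong p q \<longleftrightarrow> p - q \<in> complex_vector.span tensor_relators"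

quotient_type (overloaded) ('a, 'b) tensor =
  "('a::complex_vector \<times> 'b::complex_vector) free_vec" / tensor_cong
proof (rule equivpI)
  show "reflp (tensor_cong :: ('a \<times> 'b) free_vec \<Rightarrow> _)"
    by (auto intro!: reflpI simp: tensor_cong_def complex_vector.span_zero)
  show "symp (tensor_cong :: ('a \<times> 'b) free_vec \<Rightarrow> _)"
    by (rule sympI) (use complex_vector.span_neg in \<open>fastforce simp: tensor_cong_def\<close>)
  show "transp (tensor_cong :: ('a \<times> 'b) free_vec \<Rightarrow> _)"
  proof (rule transpI)
    fix p q r :: "('a \<times> 'b) free_vec"
    assume "tensor_cong p q" "tensor_cong q r"
    then have "(p - q) + (q - r) \<in> complex_vector.span tensor_relators"
      unfolding tensor_cong_def by (rule complex_vector.span_add)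
    then show "tensor_cong p r" by (simp add: tensor_cong_def)
  qed
qed

lemma tensor_cong_eqI: "p = q \<Longrightarrow> tensor_cong p q"
  by (simp add: tensor_cong_def complex_vector.span_zero)

instantiation tensor :: (complex_vector, complex_vector) complex_vector
begin
lift_definition zero_tensor :: "('a, 'b) tensor" is 0 .
lift_definition plus_tensor :: "('a, 'b) tensor \<Rightarrow> ('a, 'b) tensor \<Rightarrow> ('a, 'b) tensor" is "(+)"
  unfolding tensor_cong_def
  by (drule (1) complex_vector.span_add) (simp add: algebra_simps)
lift_definition minus_tensor :: "('a, 'b) tensor \<Rightarrow> ('a, 'b) tensor \<Rightarrow> ('a, 'b) tensor" is "(-)"
  unfolding tensor_cong_def
  by (drule (1) complex_vector.span_diff) (simp add: algebra_simps)
lift_definition uminus_tensor :: "('a, 'b) tensor \<Rightarrow> ('a, 'b) tensor" is uminus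
  unfolding tensor_cong_def by (drule complex_vector.span_neg) (simp add: algebra_simps)
lift_definition scaleC_tensor :: "complex \<Rightarrow> ('a, 'b) tensor \<Rightarrow> ('a, 'b) tensor" is scaleC
  unfolding tensor_cong_def scaleC_diff_right[symmetric] by (rule complex_vector.span_scale)
instance
proof
  fix r s t :: "('a, 'b) tensor" and c d :: complex
  show "r + s + t = r + (s + t)" by transfer (rule tensor_cong_eqI, rule add.assoc)
  show "r + s = s + r" by transfer (rule tensor_cong_eqI, rule add.commute)
  show "0 + r = r" by transfer (rule tensor_cong_eqI, simp)
  show "- r + r = 0" by transfer (rule tensor_cong_eqI, simp)
  show "r - s = r + - s" by transfer (rule tensor_cong_eqI, simp)
  show "c *\<^sub>C (r + s) = c *\<^sub>C r + c *\<^sub>C s"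
    by transfer (rule tensor_cong_eqI, rule scaleC_add_right)
  show "(c + d) *\<^sub>C r = c *\<^sub>C r + d *\<^sub>C r"
    by transfer (rule tensor_cong_eqI, rule scaleC_add_left)
  show "c *\<^sub>C d *\<^sub>C r = (c * d) *\<^sub>C r" by transfer (rule tensor_cong_eqI, rule scaleC_scaleC)
  show "1 *\<^sub>C r = r" by transfer (rule tensor_cong_eqI, rule scaleC_one)
qed
end

lift_definition pure_tensor ::
  "'a::complex_vector \<Rightarrow> 'b::complex_vector \<Rightarrow> ('a, 'b) tensor" (infixr \<open>\<otimes>\<^sub>C\<close> 72)
  is "\<lambda>a b. basis_vec (a, b)" .

definition tensor_lift ::
  "('a::complex_vector \<Rightarrow> 'b::complex_vector \<Rightarrow> 'c::complex_vector) \<Rightarrow> ('a, 'b) tensor \<Rightarrow> 'c"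
  where "tensor_lift f t = linear_extension (\<lambda>(a, b). f a b) (rep_tensor t)"

lemma cbilinear_pure_tensor: "cbilinear (\<otimes>\<^sub>C)"
  unfolding cbilinear_def clinear_iff
proof (intro conjI allI)
  have *: "tensor_cong p q" if "p - q \<in> tensor_relators" for p q :: "('a \<times> 'b) free_vec"
    unfolding tensor_cong_def using that by (rule complex_vector.span_base)
  show "a \<otimes>\<^sub>C (b + b') = a \<otimes>\<^sub>C b + a \<otimes>\<^sub>C b'" for a :: 'a and b b' :: 'b
    by transfer (rule *, unfold tensor_relators_def diff_diff_eq[symmetric], blast)
  show "a \<otimes>\<^sub>C (c *\<^sub>C b) = c *\<^sub>C (a \<otimes>\<^sub>C b)" for a :: 'a and b :: 'b and c
    by transfer (rule *, unfold tensor_relators_def, blast)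
  show "(a + a') \<otimes>\<^sub>C b = a \<otimes>\<^sub>C b + a' \<otimes>\<^sub>C b" for a a' :: 'a and b :: 'b
    by transfer (rule *, unfold tensor_relators_def diff_diff_eq[symmetric], blast)
  show "(c *\<^sub>C a) \<otimes>\<^sub>C b = c *\<^sub>C (a \<otimes>\<^sub>C b)" for a :: 'a and b :: 'b and c
    by transfer (rule *, unfold tensor_relators_def, blast)
qed

lemma tensor_lift_abs:
  assumes "cbilinear f"
  shows "tensor_lift f (abs_tensor p) = linear_extension (\<lambda>(a, b). f a b) p"
proof -
  let ?L = "linear_extension (\<lambda>(a, b). f a b)"
  note L = clinear_linear_extension[of "\<lambda>(a, b). f a b"]
  have 0: "?L r = 0" if "r \<in> complex_vector.span tensor_relators" for r
    using that
  proof (induction rule: complex_vector.span_induct_alt)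
    case base
    show ?case by (rule clinear_zero[OF L])
  next
    case (step c x y)
    have "?L x = 0"
      using step(1) assms unfolding tensor_relators_def
      by (auto simp: clinear_diff[OF L] clinear_scaleC[OF L] cbilinear_def clinear_iff)
    then show ?case using step by (simp add: clinear_add[OF L] clinear_scaleC[OF L])
  qed
  have "tensor_cong (rep_tensor (abs_tensor p)) p"
    by (rule Quotient3_rep_abs[OF Quotient3_tensor])
      (simp add: tensor_cong_def complex_vector.span_zero)
  then show ?thesis
    unfolding tensor_lift_def tensor_cong_def using 0 clinear_diff[OF L] by fastforce
qed

lemma tensor_lift_pure: "cbilinear f \<Longrightarrow> tensor_lift f (a \<otimes>\<^sub>C b) = f a b"
  by (simp add: pure_tensor.abs_eq tensor_lift_abs)

lemma clinear_tensor_lift: "cbilinear f \<Longrightarrow> clinear (tensor_lift f)"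
  unfolding clinear_iff
proof (intro conjI allI)
  fix x y c assume f: "cbilinear f"
  note L = clinear_linear_extension[of "\<lambda>(a, b). f a b"]
  show "tensor_lift f (x + y) = tensor_lift f x + tensor_lift f y"
    by (induction x rule: tensor.abs_induct; induction y rule: tensor.abs_induct)
      (simp add: plus_tensor.abs_eq tensor_lift_abs[OF f] clinear_add[OF L])
  show "tensor_lift f (c *\<^sub>C x) = c *\<^sub>C tensor_lift f x"
    by (induction x rule: tensor.abs_induct)
      (simp add: scaleC_tensor.abs_eq tensor_lift_abs[OF f] clinear_scaleC[OF L])
qed

lemma tensor_induct [case_names zero pure add]:
  assumes "P 0" "\<And>a b. P (a \<otimes>\<^sub>C b)" "\<And>s t. P s \<Longrightarrow> P t \<Longrightarrow> P (s + t)"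
  shows "P (t :: ('a::complex_vector, 'b::complex_vector) tensor)"
proof (induction t rule: tensor.abs_induct)
  case (1 p)
  show ?case
  proof (induction p rule: free_vec_induct)
    case zero
    show ?case using assms(1) by (simp add: zero_tensor.abs_eq)
  next
    case (add v c x)
    obtain a b where x: "x = (a, b)" by (cases x)
    have "abs_tensor (v + c *\<^sub>C basis_vec x) = abs_tensor v + (c *\<^sub>C a) \<otimes>\<^sub>C b"
      using cbilinear_pure_tensor[where 'a = 'a and 'b = 'b]
      by (simp add: x cbilinear_def clinear_iff pure_tensor.abs_eq plus_tensor.abs_eq scaleC_tensor.abs_eq)
    then show ?case using assms(2,3) add by simp
  qed
qed

lemma tensor_clinear_eqI:
  assumes "clinear f" "clinear g" "\<And>a b. f (a \<otimes>\<^sub>C b) = g (a \<otimes>\<^sub>C b)"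
  shows "f t = g t"
  by (induction t rule: tensor_induct)
    (simp_all add: assms clinear_zero clinear_add)

lemma pure_tensor_add_left: "(a + a') \<otimes>\<^sub>C b = a \<otimes>\<^sub>C b + a' \<otimes>\<^sub>C b"
  and pure_tensor_add_right: "a \<otimes>\<^sub>C (b + b') = a \<otimes>\<^sub>C b + a \<otimes>\<^sub>C b'"
  and pure_tensor_scaleC_left: "(c *\<^sub>C a) \<otimes>\<^sub>C b = c *\<^sub>C (a \<otimes>\<^sub>C b)"
  and pure_tensor_scaleC_right: "a \<otimes>\<^sub>C (c *\<^sub>C b) = c *\<^sub>C (a \<otimes>\<^sub>C b)"
  using cbilinear_pure_tensor unfolding cbilinear_def clinear_iff by blast+

lemma cbilinearI:
  assumes "\<And>a b b'. f a (b + b') = f a b + f a b'" "\<And>a c b. f a (c *\<^sub>C b) = c *\<^sub>C f a b"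
    "\<And>a a' b. f (a + a') b = f a b + f a' b" "\<And>a c b. f (c *\<^sub>C a) b = c *\<^sub>C f a b"
  shows "cbilinear f"
  using assms by (simp add: cbilinear_def clinear_iff)

definition tensor_times ::
  "('a::complex_algebra_1, 'b::complex_algebra_1) tensor \<Rightarrow> ('a, 'b) tensor \<Rightarrow> ('a, 'b) tensor"
  where "tensor_times s t =
    tensor_lift (\<lambda>a b. tensor_lift (\<lambda>c d. (a * c) \<otimes>\<^sub>C (b * d)) t) s"

lemmas pure_tensor_simps =
  pure_tensor_add_left pure_tensor_add_right pure_tensor_scaleC_left pure_tensor_scaleC_right

lemma cbilinear_times_right:
  "cbilinear (\<lambda>c d. ((a::'a::complex_algebra_1) * c) \<otimes>\<^sub>C ((b::'b::complex_algebra_1) * d))"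
  by (rule cbilinearI) (simp_all add: algebra_simps pure_tensor_simps)

lemma cbilinear_times_left:
  fixes t :: "('a::complex_algebra_1, 'b::complex_algebra_1) tensor"
  shows "cbilinear (\<lambda>a b. tensor_lift (\<lambda>c d. (a * c) \<otimes>\<^sub>C (b * d)) t)" (is "cbilinear ?f")
proof -
  define m where "m a b = tensor_lift (\<lambda>c d. (a * c) \<otimes>\<^sub>C (b * d))" for a :: 'a and b :: 'b
  have L: "clinear (m a b)" for a b
    unfolding m_def by (rule clinear_tensor_lift[OF cbilinear_times_right])
  have S: "m a b (c \<otimes>\<^sub>C d) = (a * c) \<otimes>\<^sub>C (b * d)" for a b c d
    unfolding m_def by (rule tensor_lift_pure[OF cbilinear_times_right])
  note simps = S clinear_zero[OF L] clinear_add[OF L] scaleC_add_right pure_tensor_simps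
  have "cbilinear (\<lambda>a b. m a b t)"
  proof (rule cbilinearI)
    fix a a' :: 'a and b b' :: 'b and c :: complex
    show "m a (b + b') t = m a b t + m a b' t"
      by (induction t rule: tensor_induct) (simp_all add: simps algebra_simps)
    show "m (a + a') b t = m a b t + m a' b t"
      by (induction t rule: tensor_induct) (simp_all add: simps algebra_simps)
    show "m a (c *\<^sub>C b) t = c *\<^sub>C m a b t"
      by (induction t rule: tensor_induct) (simp_all add: simps)
    show "m (c *\<^sub>C a) b t = c *\<^sub>C m a b t"
      by (induction t rule: tensor_induct) (simp_all add: simps)
  qed
  then show ?thesis by (simp add: m_def)
qed

lemma tensor_times_pure: "tensor_times (a \<otimes>\<^sub>C b) (c \<otimes>\<^sub>C d) = (a * c) \<otimes>\<^sub>C (b * d)"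
  unfolding tensor_times_def
  by (subst tensor_lift_pure[OF cbilinear_times_left], rule tensor_lift_pure[OF cbilinear_times_right])

lemma clinear_tensor_times_left: "clinear (\<lambda>s. tensor_times s t)"
  unfolding tensor_times_def by (rule clinear_tensor_lift[OF cbilinear_times_left])

lemma clinear_tensor_times_right: "clinear (tensor_times s)"
proof -
  note L = clinear_tensor_times_left
  have P: "tensor_times (a \<otimes>\<^sub>C b) t = tensor_lift (\<lambda>c d. (a * c) \<otimes>\<^sub>C (b * d)) t"
    for a :: 'a and b :: 'b and t
    unfolding tensor_times_def by (simp add: tensor_lift_pure cbilinear_times_left)
  note R = clinear_tensor_lift[OF cbilinear_times_right]
  have "tensor_times s (x + y) = tensor_times s x + tensor_times s y" for x y
    by (induction s rule: tensor_induct)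
      (simp_all add: P clinear_zero[OF L] clinear_add[OF L] clinear_add[OF R])
  moreover have "tensor_times s (c *\<^sub>C x) = c *\<^sub>C tensor_times s x" for c x
    by (induction s rule: tensor_induct)
      (simp_all add: P clinear_zero[OF L] clinear_add[OF L] clinear_scaleC[OF R] scaleC_add_right)
  ultimately show ?thesis by (simp add: clinear_iff)
qed

instantiation tensor :: (complex_algebra_1, complex_algebra_1) complex_algebra_1
begin
definition one_tensor :: "('a, 'b) tensor" where "1 = 1 \<otimes>\<^sub>C 1"
definition times_tensor :: "('a, 'b) tensor \<Rightarrow> ('a, 'b) tensor \<Rightarrow> ('a, 'b) tensor"
  where "s * t = tensor_times s t"
instance
proof
  note L = clinear_tensor_times_left and R = clinear_tensor_times_right
  note lin = clinear_zero[OF L] clinear_zero[OF R] clinear_add[OF L] clinear_add[OF R]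
    clinear_scaleC[OF L] clinear_scaleC[OF R]
  fix r s t :: "('a, 'b) tensor" and c :: complex
  show "(r + s) * t = r * t + s * t" "r * (s + t) = r * s + r * t"
    "(c *\<^sub>C s) * t = c *\<^sub>C (s * t)" "s * (c *\<^sub>C t) = c *\<^sub>C (s * t)"
    by (simp_all add: times_tensor_def lin)
  show "1 * s = s"
    by (induction s rule: tensor_induct)
      (simp_all add: times_tensor_def one_tensor_def lin tensor_times_pure)
  show "s * 1 = s"
    by (induction s rule: tensor_induct)
      (simp_all add: times_tensor_def one_tensor_def lin tensor_times_pure)
  show "r * s * t = r * (s * t)"
    unfolding times_tensor_def
  proof (induction r rule: tensor_induct)
    case (pure a b)
    show ?case
    proof (induction s rule: tensor_induct)
      case (pure a' b')
      show ?case
        by (induction t rule: tensor_induct) (simp_all add: lin tensor_times_pure mult.assoc)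
    qed (simp_all add: lin)
  qed (simp_all add: lin)
qed
end

lemma pure_tensor_times [simp]: "(a \<otimes>\<^sub>C b) * (c \<otimes>\<^sub>C d) = (a * c) \<otimes>\<^sub>C (b * d)"
  by (simp add: times_tensor_def tensor_times_pure)

lemma cbilinear_tensor_map:
  "clinear f \<Longrightarrow> clinear g \<Longrightarrow> cbilinear (\<lambda>v w. f v \<otimes>\<^sub>C g w)"
  by (rule cbilinearI) (simp_all add: clinear_add clinear_scaleC pure_tensor_simps)

lift_definition cendo_tensor ::
  "'v::complex_vector cendo \<Rightarrow> 'w::complex_vector cendo \<Rightarrow> ('v, 'w) tensor cendo"
  is "\<lambda>f g. tensor_lift (\<lambda>v w. f v \<otimes>\<^sub>C g w)"
  by (intro clinear_tensor_lift cbilinear_tensor_map)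

text \<open>The tensor product of a representation of \<open>'a\<close> on \<open>'v\<close> and a representation of \<open>'b\<close> on \<open>'w\<close>,
  as a representation of the tensor product of the algebras.\<close>

definition tensor_rep ::
  "('a::complex_algebra_1 \<Rightarrow> 'v::complex_vector cendo) \<Rightarrow>
   ('b::complex_algebra_1 \<Rightarrow> 'w::complex_vector cendo) \<Rightarrow> ('a, 'b) tensor \<Rightarrow> ('v, 'w) tensor cendo"
  where "tensor_rep \<rho> \<sigma> = tensor_lift (\<lambda>a b. cendo_tensor (\<rho> a) (\<sigma> b))"

section \<open>The universal enveloping algebra of $\mathfrak{sl}_2$\<close>

datatype sl2_gen = GE | GF | GH

instantiation sl2_gen :: presentation
begin
inductive relation_sl2_gen :: "sl2_gen alg_term \<Rightarrow> sl2_gen alg_term \<Rightarrow> bool" where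
  "relation_sl2_gen (tcomm (Gen GH) (Gen GE)) (Scal 2 \<otimes>\<^sub>t Gen GE)"
| "relation_sl2_gen (tcomm (Gen GH) (Gen GF)) (Scal (-2) \<otimes>\<^sub>t Gen GF)"
| "relation_sl2_gen (tcomm (Gen GE) (Gen GF)) (Gen GH)"
instance ..
end

type_synonym usl2 = "sl2_gen presented"

definition sl2_E :: usl2 where "sl2_E = generator GE"
definition sl2_F :: usl2 where "sl2_F = generator GF"
definition sl2_H :: usl2 where "sl2_H = generator GH"

definition casimir :: usl2
  where "casimir = sl2_E * sl2_F + sl2_F * sl2_E + (1/2) *\<^sub>C sl2_H^2"

definition usl2_hom :: "'b \<Rightarrow> 'b \<Rightarrow> 'b \<Rightarrow> usl2 \<Rightarrow> 'b::complex_algebra_1"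
  where "usl2_hom e f h = presented_hom (\<lambda>g. case g of GE \<Rightarrow> e | GF \<Rightarrow> f | GH \<Rightarrow> h)"

definition comult :: "usl2 \<Rightarrow> (usl2, usl2) tensor"
  where "comult = usl2_hom (sl2_E \<otimes>\<^sub>C 1 + 1 \<otimes>\<^sub>C sl2_E) (sl2_F \<otimes>\<^sub>C 1 + 1 \<otimes>\<^sub>C sl2_F)
    (sl2_H \<otimes>\<^sub>C 1 + 1 \<otimes>\<^sub>C sl2_H)"

section \<open>The universal Hahn algebra\<close>

datatype hahn_gen = GA | GB | GC

definition hahn_term1 :: "hahn_gen alg_term"
  where "hahn_term1 = tcomm (Gen GC) (Gen GA) \<oplus>\<^sub>t Scal 2 \<otimes>\<^sub>t (Gen GA \<otimes>\<^sub>t Gen GA) \<oplus>\<^sub>t Gen GB"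

definition hahn_term2 :: "hahn_gen alg_term"
  where "hahn_term2 =
    tcomm (Gen GB) (Gen GC) \<oplus>\<^sub>t Scal 4 \<otimes>\<^sub>t (Gen GB \<otimes>\<^sub>t Gen GA) \<oplus>\<^sub>t Scal 2 \<otimes>\<^sub>t Gen GC"

instantiation hahn_gen :: presentation
begin
inductive relation_hahn_gen :: "hahn_gen alg_term \<Rightarrow> hahn_gen alg_term \<Rightarrow> bool" where
  "relation_hahn_gen (tcomm (Gen GA) (Gen GB)) (Gen GC)"
| "relation_hahn_gen (hahn_term1 \<otimes>\<^sub>t t) (t \<otimes>\<^sub>t hahn_term1)"
| "relation_hahn_gen (hahn_term2 \<otimes>\<^sub>t t) (t \<otimes>\<^sub>t hahn_term2)"
instance ..
end

type_synonym hahn = "hahn_gen presented"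

definition hahn_hom :: "'b \<Rightarrow> 'b \<Rightarrow> 'b \<Rightarrow> hahn \<Rightarrow> 'b::complex_algebra_1"
  where "hahn_hom a b c = presented_hom (\<lambda>g. case g of GA \<Rightarrow> a | GB \<Rightarrow> b | GC \<Rightarrow> c)"

definition natural_hom :: "hahn \<Rightarrow> (usl2, usl2) tensor"
  where "natural_hom = hahn_hom
    ((1/4) *\<^sub>C (sl2_H \<otimes>\<^sub>C 1 - 1 \<otimes>\<^sub>C sl2_H))
    ((1/2) *\<^sub>C comult casimir)
    (sl2_E \<otimes>\<^sub>C sl2_F - sl2_F \<otimes>\<^sub>C sl2_E)"

section \<open>The modules\<close>

definition span_of :: "'x set \<Rightarrow> 'x free_vec set"
  where "span_of X = {v. Poly_Mapping.keys v \<subseteq> X}"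

text \<open>The operators \<open>E\<close>, \<open>F\<close>, \<open>H\<close> on \<^term>\<open>span_of (Pow S)\<close>. They are extended by zero to the basis
  vectors outside \<^term>\<open>Pow S\<close>: the ambient free vector space is then, for finite \<open>S\<close>, a module
  that contains \<^term>\<open>span_of (Pow S)\<close> as a submodule (with a trivial complement).\<close>

definition pow_E :: "'a set \<Rightarrow> 'a set \<Rightarrow> 'a set free_vec"
  where "pow_E S x = (if x \<subseteq> S then \<Sum>y | y \<subseteq> x \<and> card y + 1 = card x. basis_vec y else 0)"

definition pow_F :: "'a set \<Rightarrow> 'a set \<Rightarrow> 'a set free_vec"
  where "pow_F S x =
    (if x \<subseteq> S then \<Sum>y | y \<subseteq> S \<and> x \<subseteq> y \<and> card y = card x + 1. basis_vec y else 0)"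

definition pow_H :: "'a set \<Rightarrow> 'a set \<Rightarrow> 'a set free_vec"
  where "pow_H S x =
    (if x \<subseteq> S then (of_nat (card S) - 2 * of_nat (card x)) *\<^sub>C basis_vec x else 0)"

definition pow_rep :: "'a set \<Rightarrow> usl2 \<Rightarrow> 'a set free_vec cendo"
  where "pow_rep S = usl2_hom (linear_extension_endo (pow_E S)) (linear_extension_endo (pow_F S))
    (linear_extension_endo (pow_H S))"

definition iota :: "'a set \<Rightarrow> 'a set free_vec \<Rightarrow> ('a set free_vec, 'a set free_vec) tensor"
  where "iota x\<^sub>0 = linear_extension (\<lambda>x. basis_vec (x - x\<^sub>0) \<otimes>\<^sub>C basis_vec (x \<inter> x\<^sub>0))"

text \<open>Transport of structure along \<^const>\<open>iota\<close>; only meaningful on \<^term>\<open>span_of (Pow \<Omega>)\<close>.\<close>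

definition usl2_tensor_action ::
  "'a set \<Rightarrow> 'a set \<Rightarrow> (usl2, usl2) tensor \<Rightarrow> 'a set free_vec \<Rightarrow> 'a set free_vec"
  where "usl2_tensor_action \<Omega> x\<^sub>0 u v =
    inv_into (span_of (Pow \<Omega>)) (iota x\<^sub>0)
      (cendo_apply (tensor_rep (pow_rep (\<Omega> - x\<^sub>0)) (pow_rep x\<^sub>0) u) (iota x\<^sub>0 v))"

definition hahn_action :: "'a set \<Rightarrow> 'a set \<Rightarrow> hahn \<Rightarrow> 'a set free_vec \<Rightarrow> 'a set free_vec"
  where "hahn_action \<Omega> x\<^sub>0 h = usl2_tensor_action \<Omega> x\<^sub>0 (natural_hom h)"

text \<open>Endomorphisms of a subspace \<open>V\<close> are represented by extensional functions on \<open>V\<close>.\<close>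

definition End_on :: "'v::complex_vector set \<Rightarrow> ('v \<Rightarrow> 'v) set"
  where "End_on V = {f \<in> V \<rightarrow>\<^sub>E V.
    (\<forall>v\<in>V. \<forall>w\<in>V. f (v + w) = f v + f w) \<and> (\<forall>c. \<forall>v\<in>V. f (c *\<^sub>C v) = c *\<^sub>C f v)}"

definition johnson_space :: "'a set \<Rightarrow> nat \<Rightarrow> 'a set free_vec set"
  where "johnson_space \<Omega> k = span_of (nsets \<Omega> k)"

definition hahn_rep ::
  "'a set \<Rightarrow> nat \<Rightarrow> 'a set \<Rightarrow> hahn \<Rightarrow> 'a set free_vec \<Rightarrow> 'a set free_vec"
  where "hahn_rep \<Omega> k x\<^sub>0 h = restrict (hahn_action \<Omega> x\<^sub>0 h) (johnson_space \<Omega> k)"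

section \<open>The Terwilliger algebra of the Johnson graph\<close>

inductive_set generated_subalgebra :: "'v::complex_vector set \<Rightarrow> ('v \<Rightarrow> 'v) set \<Rightarrow> ('v \<Rightarrow> 'v) set"
  for V G where
  subalg_base: "f \<in> G \<Longrightarrow> f \<in> generated_subalgebra V G"
| subalg_one: "(\<lambda>v\<in>V. v) \<in> generated_subalgebra V G"
| subalg_add: "f \<in> generated_subalgebra V G \<Longrightarrow> g \<in> generated_subalgebra V G \<Longrightarrow>
    (\<lambda>v\<in>V. f v + g v) \<in> generated_subalgebra V G"
| subalg_scale: "f \<in> generated_subalgebra V G \<Longrightarrow> (\<lambda>v\<in>V. c *\<^sub>C f v) \<in> generated_subalgebra V G"
| subalg_mult: "f \<in> generated_subalgebra V G \<Longrightarrow> g \<in> generated_subalgebra V G \<Longrightarrow>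
    compose V f g \<in> generated_subalgebra V G"

definition johnson_adjacency :: "'a set \<Rightarrow> nat \<Rightarrow> 'a set free_vec \<Rightarrow> 'a set free_vec"
  where "johnson_adjacency \<Omega> k = restrict
    (linear_extension (\<lambda>x. \<Sum>y | y \<in> nsets \<Omega> k \<and> card (x \<inter> y) + 1 = k. basis_vec y))
    (johnson_space \<Omega> k)"

definition johnson_dual_adjacency ::
  "'a set \<Rightarrow> nat \<Rightarrow> 'a set \<Rightarrow> 'a set free_vec \<Rightarrow> 'a set free_vec"
  where "johnson_dual_adjacency \<Omega> k x\<^sub>0 = restrict
    (linear_extension (\<lambda>x.
      ((of_nat (card \<Omega>) - 1) *
       (1 - of_nat (card \<Omega>) * of_nat (card (x\<^sub>0 - x) + card (x - x\<^sub>0)) /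
            (2 * of_nat k * (of_nat (card \<Omega>) - of_nat k)))) *\<^sub>C basis_vec x))
    (johnson_space \<Omega> k)"

definition terwilliger_algebra ::
  "'a set \<Rightarrow> nat \<Rightarrow> 'a set \<Rightarrow> ('a set free_vec \<Rightarrow> 'a set free_vec) set"
  where "terwilliger_algebra \<Omega> k x\<^sub>0 = generated_subalgebra (johnson_space \<Omega> k)
    {johnson_adjacency \<Omega> k, johnson_dual_adjacency \<Omega> k x\<^sub>0}"

section \<open>The homomorphisms and representations are well defined\<close>

lemma respects_relations_sl2:
  assumes "h * e - e * h = 2 *\<^sub>C e" "h * f - f * h = (-2) *\<^sub>C f" "e * f - f * e = h"
  shows "respects_relations (\<lambda>g. case g of GE \<Rightarrow> e | GF \<Rightarrow> f | GH \<Rightarrow> h)"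
  unfolding respects_relations_def
  by (auto elim!: relation_sl2_gen.cases simp: assms scaleC_minus_left simp flip: diff_conv_add_uminus)

lemma usl2_relations:
  "sl2_H * sl2_E - sl2_E * sl2_H = 2 *\<^sub>C sl2_E"
  "sl2_H * sl2_F - sl2_F * sl2_H = (-2) *\<^sub>C sl2_F"
  "sl2_E * sl2_F - sl2_F * sl2_E = sl2_H"
  unfolding sl2_E_def sl2_F_def sl2_H_def
  by (transfer, rule alg_cong.ac_rel, rule relation_sl2_gen.intros)+

lemma algebra_hom_usl2_hom:
  assumes "h * e - e * h = 2 *\<^sub>C e" "h * f - f * h = (-2) *\<^sub>C f" "e * f - f * e = h"
  shows "algebra_hom (usl2_hom e f h)" "usl2_hom e f h sl2_E = e" "usl2_hom e f h sl2_F = f"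
    "usl2_hom e f h sl2_H = h"
  using respects_relations_sl2[OF assms]
  by (simp_all add: usl2_hom_def sl2_E_def sl2_F_def sl2_H_def algebra_hom_presented_hom
      presented_hom_generator)

lemma pure_tensor_diff_left: "(a - a') \<otimes>\<^sub>C b = a \<otimes>\<^sub>C b - a' \<otimes>\<^sub>C b"
  using pure_tensor_add_left[of "a - a'" a' b] by (simp add: algebra_simps)

lemma pure_tensor_diff_right: "a \<otimes>\<^sub>C (b - b') = a \<otimes>\<^sub>C b - a \<otimes>\<^sub>C b'"
  using pure_tensor_add_right[of a "b - b'" b'] by (simp add: algebra_simps)

lemma pure_tensor_minus_left: "(- a) \<otimes>\<^sub>C b = - (a \<otimes>\<^sub>C b)"
  using pure_tensor_scaleC_left[of "-1" a b] by (simp add: scaleC_minus_left)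

lemma pure_tensor_minus_right: "a \<otimes>\<^sub>C (- b) = - (a \<otimes>\<^sub>C b)"
  using pure_tensor_scaleC_right[of a "-1" b] by (simp add: scaleC_minus_left)

lemma algebra_hom_comult:
  "algebra_hom comult" "comult sl2_E = sl2_E \<otimes>\<^sub>C 1 + 1 \<otimes>\<^sub>C sl2_E"
  "comult sl2_F = sl2_F \<otimes>\<^sub>C 1 + 1 \<otimes>\<^sub>C sl2_F" "comult sl2_H = sl2_H \<otimes>\<^sub>C 1 + 1 \<otimes>\<^sub>C sl2_H"
proof -
  have *: "(a \<otimes>\<^sub>C 1 + 1 \<otimes>\<^sub>C a) * (b \<otimes>\<^sub>C 1 + 1 \<otimes>\<^sub>C b) - (b \<otimes>\<^sub>C 1 + 1 \<otimes>\<^sub>C b) * (a \<otimes>\<^sub>C 1 + 1 \<otimes>\<^sub>C a) =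
      (a * b - b * a) \<otimes>\<^sub>C 1 + 1 \<otimes>\<^sub>C (a * b - b * a)" for a b :: usl2
    by (simp add: ring_distribs pure_tensor_diff_left pure_tensor_diff_right)
  show "algebra_hom comult" "comult sl2_E = sl2_E \<otimes>\<^sub>C 1 + 1 \<otimes>\<^sub>C sl2_E"
    "comult sl2_F = sl2_F \<otimes>\<^sub>C 1 + 1 \<otimes>\<^sub>C sl2_F" "comult sl2_H = sl2_H \<otimes>\<^sub>C 1 + 1 \<otimes>\<^sub>C sl2_H"
    unfolding comult_def
    by (rule algebra_hom_usl2_hom;
        simp add: * usl2_relations pure_tensor_simps pure_tensor_minus_left
          pure_tensor_minus_right scaleC_minus_left scaleC_add_right)+
qed

lemma respects_relations_hahn:
  fixes a b c :: "'b::complex_algebra_1"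
  defines "\<alpha> \<equiv> c * a - a * c + 2 *\<^sub>C (a * a) + b"
  defines "\<beta> \<equiv> b * c - c * b + 4 *\<^sub>C (b * a) + 2 *\<^sub>C c"
  assumes "a * b - b * a = c"
    and "\<alpha> * a = a * \<alpha>" "\<alpha> * b = b * \<alpha>" "\<alpha> * c = c * \<alpha>"
    and "\<beta> * a = a * \<beta>" "\<beta> * b = b * \<beta>" "\<beta> * c = c * \<beta>"
  shows "respects_relations (\<lambda>g. case g of GA \<Rightarrow> a | GB \<Rightarrow> b | GC \<Rightarrow> c)" (is "respects_relations ?\<phi>")
proof -
  have comm: "z * eval_term ?\<phi> t = eval_term ?\<phi> t * z"
    if z: "z * a = a * z" "z * b = b * z" "z * c = c * z" for z t
  proof (induction t)
    case (Gen g)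
    then show ?case by (cases g) (simp_all add: z)
  next
    case (Times s t)
    then show ?case by (simp add: mult.assoc) (metis mult.assoc)
  qed (simp_all add: ring_distribs)
  have "eval_term ?\<phi> hahn_term1 = \<alpha>" "eval_term ?\<phi> hahn_term2 = \<beta>"
    by (simp_all add: hahn_term1_def hahn_term2_def \<alpha>_def \<beta>_def scaleC_minus_left)
  then show ?thesis
    unfolding respects_relations_def
    using comm[of \<alpha>] comm[of \<beta>] assms(3-)
    by (auto elim!: relation_hahn_gen.cases simp: scaleC_minus_left)
qed

definition commuting :: "'b::complex_algebra_1 \<Rightarrow> 'b \<Rightarrow> bool"
  where "commuting z x \<longleftrightarrow> z * x = x * z"

lemma commuting_intros:
  "commuting z x \<Longrightarrow> commuting z y \<Longrightarrow> commuting z (x + y)"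
  "commuting z x \<Longrightarrow> commuting z y \<Longrightarrow> commuting z (x - y)"
  "commuting z x \<Longrightarrow> commuting z y \<Longrightarrow> commuting z (x * y)"
  "commuting z x \<Longrightarrow> commuting z (c *\<^sub>C x)"
  "commuting z 1"
  unfolding commuting_def
  by (simp_all add: ring_distribs right_diff_distrib left_diff_distrib) (metis mult.assoc)

lemma commuting_sym: "commuting x y \<Longrightarrow> commuting y x"
  by (simp add: commuting_def)

lemma scaleC_numeral_expand:
  "numeral (num.Bit0 n) *\<^sub>C x = numeral n *\<^sub>C x + numeral n *\<^sub>C x"
  "numeral (num.Bit1 n) *\<^sub>C x = numeral n *\<^sub>C x + numeral n *\<^sub>C x + x"
  "numeral num.One *\<^sub>C x = x"
  by (simp_all only: numeral.simps scaleC_add_left scaleC_one)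

lemma hahn_relations_sl2:
  fixes e1 f1 h1 e2 f2 h2 :: "'b::complex_algebra_1"
  assumes r1: "h1 * e1 - e1 * h1 = 2 *\<^sub>C e1" "h1 * f1 - f1 * h1 = (-2) *\<^sub>C f1" "e1 * f1 - f1 * e1 = h1"
    and r2: "h2 * e2 - e2 * h2 = 2 *\<^sub>C e2" "h2 * f2 - f2 * h2 = (-2) *\<^sub>C f2" "e2 * f2 - f2 * e2 = h2"
    and cm: "e2 * e1 = e1 * e2" "e2 * f1 = f1 * e2" "e2 * h1 = h1 * e2"
      "f2 * e1 = e1 * f2" "f2 * f1 = f1 * f2" "f2 * h1 = h1 * f2"
      "h2 * e1 = e1 * h2" "h2 * f1 = f1 * h2" "h2 * h1 = h1 * h2"
  defines "a \<equiv> (1/4) *\<^sub>C (h1 - h2)"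
    and "b \<equiv> (1/2) *\<^sub>C ((e1 + e2) * (f1 + f2) + (f1 + f2) * (e1 + e2) + (1/2) *\<^sub>C ((h1 + h2) * (h1 + h2)))"
    and "c \<equiv> e1 * f2 - f1 * e2"
  defines "L1 \<equiv> e1 * f1 + f1 * e1 + (1/2) *\<^sub>C (h1 * h1)"
    and "L2 \<equiv> e2 * f2 + f2 * e2 + (1/2) *\<^sub>C (h2 * h2)"
  shows "a * b - b * a = c"
    and "c * a - a * c + 2 *\<^sub>C (a * a) + b = (1/2) *\<^sub>C (L1 + L2) + (1/8) *\<^sub>C ((h1 + h2) * (h1 + h2))"
    and "b * c - c * b + 4 *\<^sub>C (b * a) + 2 *\<^sub>C c = (1/2) *\<^sub>C ((L1 - L2) * (h1 + h2))"
    and "b = (1/2) *\<^sub>C (L1 + L2) + e1 * f2 + f1 * e2 + (1/2) *\<^sub>C (h1 * h2)"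
    and "L1 * e1 = e1 * L1" "L1 * f1 = f1 * L1" "L1 * h1 = h1 * L1"
    and "L2 * e2 = e2 * L2" "L2 * f2 = f2 * L2" "L2 * h2 = h2 * L2"
proof -
  have s1: "h1 * e1 = e1 * h1 + (e1 + e1)" "h1 * f1 = f1 * h1 - (f1 + f1)" "e1 * f1 = f1 * e1 + h1"
    using r1 by (simp_all add: diff_eq_eq scaleC_minus_left scaleC_numeral_expand algebra_simps)
  have s2: "h2 * e2 = e2 * h2 + (e2 + e2)" "h2 * f2 = f2 * h2 - (f2 + f2)" "e2 * f2 = f2 * e2 + h2"
    using r2 by (simp_all add: diff_eq_eq scaleC_minus_left scaleC_numeral_expand algebra_simps)
  have assoc: "x * (y * w) = z * w" if "x * y = z" for x y z w :: 'b
    using that by (metis mult.assoc)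
  note rules = s1 s2 cm s1[THEN assoc] s2[THEN assoc] cm[THEN assoc]
  note pbw = ring_distribs left_diff_distrib right_diff_distrib mult.assoc scaleC_add_right
    scaleC_diff_right scaleC_minus_left scaleC_minus_right rules
  have scale: "x = y" if "8 *\<^sub>C x = 8 *\<^sub>C y" for x y :: 'b
  proof -
    have "(1/8) *\<^sub>C (8 *\<^sub>C x) = (1/8) *\<^sub>C (8 *\<^sub>C y)" using that by simp
    then show ?thesis by simp
  qed
  show "a * b - b * a = c"
    unfolding a_def b_def c_def
    by (rule scale) (simp add: pbw, simp add: scaleC_numeral_expand algebra_simps)
  show "c * a - a * c + 2 *\<^sub>C (a * a) + b = (1/2) *\<^sub>C (L1 + L2) + (1/8) *\<^sub>C ((h1 + h2) * (h1 + h2))"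
    unfolding a_def b_def c_def L1_def L2_def
    by (rule scale) (simp add: pbw, simp add: scaleC_numeral_expand algebra_simps)
  show "b * c - c * b + 4 *\<^sub>C (b * a) + 2 *\<^sub>C c = (1/2) *\<^sub>C ((L1 - L2) * (h1 + h2))"
    unfolding a_def b_def c_def L1_def L2_def
    by (rule scale) (simp add: pbw, simp add: scaleC_numeral_expand algebra_simps)
  show "b = (1/2) *\<^sub>C (L1 + L2) + e1 * f2 + f1 * e2 + (1/2) *\<^sub>C (h1 * h2)"
    unfolding b_def L1_def L2_def
    by (rule scale) (simp add: pbw, simp add: scaleC_numeral_expand algebra_simps)
  show "L1 * e1 = e1 * L1" "L1 * f1 = f1 * L1"
    unfolding L1_def
    by (rule scale, simp add: pbw, simp add: scaleC_numeral_expand algebra_simps)+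
  show "L1 * h1 = h1 * L1"
    unfolding L1_def by (rule scale) (simp add: pbw)
  show "L2 * e2 = e2 * L2" "L2 * f2 = f2 * L2"
    unfolding L2_def
    by (rule scale, simp add: pbw, simp add: scaleC_numeral_expand algebra_simps)+
  show "L2 * h2 = h2 * L2"
    unfolding L2_def by (rule scale) (simp add: pbw)
qed

lemma algebra_hom_simps:
  assumes "algebra_hom f"
  shows "f (x + y) = f x + f y" "f (x - y) = f x - f y" "f (- x) = - f x" "f 0 = 0" "f 1 = 1"
    "f (x * y) = f x * f y" "f (c *\<^sub>C x) = c *\<^sub>C f x"
  using assms by (simp_all add: algebra_hom_def clinear_add clinear_scaleC clinear_zero clinear_diff
      clinear_minus)

lemma comult_casimir:
  fixes e1 e2 f1 f2 h1 h2
  defines "e1 \<equiv> sl2_E \<otimes>\<^sub>C 1" and "e2 \<equiv> 1 \<otimes>\<^sub>C sl2_E"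
    and "f1 \<equiv> sl2_F \<otimes>\<^sub>C 1" and "f2 \<equiv> 1 \<otimes>\<^sub>C sl2_F"
    and "h1 \<equiv> sl2_H \<otimes>\<^sub>C 1" and "h2 \<equiv> 1 \<otimes>\<^sub>C sl2_H"
  shows "comult casimir =
    (e1 + e2) * (f1 + f2) + (f1 + f2) * (e1 + e2) + (1/2) *\<^sub>C ((h1 + h2) * (h1 + h2))"
  by (simp add: casimir_def power2_eq_square algebra_hom_simps[OF algebra_hom_comult(1)]
      algebra_hom_comult(2-4) assms)

lemma algebra_hom_natural_hom:
  "algebra_hom natural_hom"
  "natural_hom (generator GA) = (1/4) *\<^sub>C (sl2_H \<otimes>\<^sub>C 1 - 1 \<otimes>\<^sub>C sl2_H)"
  "natural_hom (generator GB) = (1/2) *\<^sub>C comult casimir"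
  "natural_hom (generator GC) = sl2_E \<otimes>\<^sub>C sl2_F - sl2_F \<otimes>\<^sub>C sl2_E"
  "commuting (comult sl2_H) (natural_hom u)"
proof -
  define e1 e2 f1 f2 h1 h2 where "e1 = sl2_E \<otimes>\<^sub>C (1::usl2)" and "e2 = (1::usl2) \<otimes>\<^sub>C sl2_E"
    and "f1 = sl2_F \<otimes>\<^sub>C (1::usl2)" and "f2 = (1::usl2) \<otimes>\<^sub>C sl2_F"
    and "h1 = sl2_H \<otimes>\<^sub>C (1::usl2)" and "h2 = (1::usl2) \<otimes>\<^sub>C sl2_H"
  note defs = e1_def e2_def f1_def f2_def h1_def h2_def
  have r: "h1 * e1 - e1 * h1 = 2 *\<^sub>C e1" "h1 * f1 - f1 * h1 = (-2) *\<^sub>C f1" "e1 * f1 - f1 * e1 = h1"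
    "h2 * e2 - e2 * h2 = 2 *\<^sub>C e2" "h2 * f2 - f2 * h2 = (-2) *\<^sub>C f2" "e2 * f2 - f2 * e2 = h2"
    by (simp_all add: defs usl2_relations pure_tensor_simps pure_tensor_minus_left
        pure_tensor_minus_right flip: pure_tensor_diff_left pure_tensor_diff_right)
  have cm: "e2 * e1 = e1 * e2" "e2 * f1 = f1 * e2" "e2 * h1 = h1 * e2"
      "f2 * e1 = e1 * f2" "f2 * f1 = f1 * f2" "f2 * h1 = h1 * f2"
      "h2 * e1 = e1 * h2" "h2 * f1 = f1 * h2" "h2 * h1 = h1 * h2"
    by (simp_all add: defs)
  define L1 L2 where "L1 = e1 * f1 + f1 * e1 + (1/2) *\<^sub>C (h1 * h1)"
    and "L2 = e2 * f2 + f2 * e2 + (1/2) *\<^sub>C (h2 * h2)"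
  define a b c where "a = (1/4) *\<^sub>C (h1 - h2)" and "b = (1/2) *\<^sub>C comult casimir"
    and "c = e1 * f2 - f1 * e2"
  have b_eq: "b = (1/2) *\<^sub>C ((e1 + e2) * (f1 + f2) + (f1 + f2) * (e1 + e2) + (1/2) *\<^sub>C ((h1 + h2) * (h1 + h2)))"
    by (simp add: b_def comult_casimir defs)
  note R = hahn_relations_sl2[OF r cm, folded L1_def L2_def, folded a_def b_eq c_def]
  have cm': "commuting x y" "commuting y x" if "x \<in> {e1, f1, h1}" "y \<in> {e2, f2, h2}" for x y
    using that cm by (auto simp: commuting_def)
  have L1: "commuting L1 x" if "x \<in> {e1, f1, h1, e2, f2, h2}" for x
  proof (cases "x \<in> {e1, f1, h1}")
    case True
    then show ?thesis using R by (auto simp: commuting_def)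
  next
    case False
    then have "commuting x L1" unfolding L1_def using that by (intro commuting_intros cm') auto
    then show ?thesis by (rule commuting_sym)
  qed
  have L2: "commuting L2 x" if "x \<in> {e1, f1, h1, e2, f2, h2}" for x
  proof (cases "x \<in> {e2, f2, h2}")
    case True
    then show ?thesis using R by (auto simp: commuting_def)
  next
    case False
    then have "commuting x L2" unfolding L2_def using that by (intro commuting_intros cm') auto
    then show ?thesis by (rule commuting_sym)
  qed
  have Ls: "commuting L1 e1" "commuting L1 f1" "commuting L1 h1" "commuting L1 e2" "commuting L1 f2"
    "commuting L1 h2" "commuting L2 e1" "commuting L2 f1" "commuting L2 h1" "commuting L2 e2"
    "commuting L2 f2" "commuting L2 h2"
    by (rule L1 L2, blast)+
  have LL: "commuting L1 L1" "commuting L2 L2" by (simp_all add: commuting_def)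
  have L12: "commuting L1 L2" unfolding L2_def by (intro commuting_intros L1) auto
  have Lh: "commuting (h1 + h2) L1" "commuting (h1 + h2) L2"
    by (rule commuting_sym, intro commuting_intros L1 L2, auto)+
  have Lx: "commuting L1 x" "commuting L2 x" if "x \<in> {a, b, c}" for x
    using that unfolding a_def R(4) c_def
    by (auto intro!: commuting_intros LL L12 commuting_sym[OF L12] Ls)
  have hh: "commuting h1 h1" "commuting h2 h2" "commuting h1 h2" "commuting h2 h1"
    using cm by (auto simp: commuting_def)
  have hx: "commuting (h1 + h2) h1" "commuting (h1 + h2) h2"
    by (rule commuting_sym, intro commuting_intros hh)+
  have x: "commuting (h1 + h2) (e1 * f2)" "commuting (h1 + h2) (f1 * e2)"
  proof -
    have *: "h1 * e1 = e1 * h1 + 2 *\<^sub>C e1" "h1 * f1 = f1 * h1 - 2 *\<^sub>C f1"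
      "h2 * e2 = e2 * h2 + 2 *\<^sub>C e2" "h2 * f2 = f2 * h2 - 2 *\<^sub>C f2"
      using r by (simp_all add: diff_eq_eq scaleC_minus_left algebra_simps)
    have assoc: "x * (y * w) = z * w" if "x * y = z" for x y z w :: "(usl2, usl2) tensor"
      using that by (metis mult.assoc)
    show "commuting (h1 + h2) (e1 * f2)" "commuting (h1 + h2) (f1 * e2)"
      unfolding commuting_def
      by (simp_all add: ring_distribs left_diff_distrib right_diff_distrib mult.assoc
          * *[THEN assoc] cm cm[THEN assoc])
  qed
  have hx': "commuting (h1 + h2) x" if "x \<in> {a, b, c}" for x
    using that unfolding a_def R(4) c_def
    by (auto intro!: commuting_intros(1,2,4) commuting_intros(3)[of _ h1 h2] Lh hx x)
  have c_eq: "c = sl2_E \<otimes>\<^sub>C sl2_F - sl2_F \<otimes>\<^sub>C sl2_E"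
    by (simp add: c_def defs)
  note xh = commuting_sym[OF hx'] and xL = commuting_sym[OF Lx(1)] commuting_sym[OF Lx(2)]
  have alpha: "commuting x (c * a - a * c + 2 *\<^sub>C (a * a) + b)"
    and beta: "commuting x (b * c - c * b + 4 *\<^sub>C (b * a) + 2 *\<^sub>C c)" if "x \<in> {a, b, c}" for x
    unfolding R(2,3)
    by (intro commuting_intros(2,4) commuting_intros(3)[of _ _ "h1 + h2"] xh[OF that]
        commuting_intros(1)[of _ L1 L2] commuting_intros(1)[of _ "_ *\<^sub>C _"] xL[OF that])+
  have resp: "respects_relations (\<lambda>g. case g of GA \<Rightarrow> a | GB \<Rightarrow> b | GC \<Rightarrow> c)"
    by (rule respects_relations_hahn[OF R(1)])
      (use alpha beta in \<open>simp_all add: commuting_def\<close>)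
  have nat: "natural_hom = presented_hom (\<lambda>g. case g of GA \<Rightarrow> a | GB \<Rightarrow> b | GC \<Rightarrow> c)"
    unfolding natural_hom_def hahn_hom_def a_def b_def c_eq h1_def h2_def ..
  show hom: "algebra_hom natural_hom" unfolding nat by (rule algebra_hom_presented_hom[OF resp])
  show "natural_hom (generator GA) = (1/4) *\<^sub>C (sl2_H \<otimes>\<^sub>C 1 - 1 \<otimes>\<^sub>C sl2_H)"
    "natural_hom (generator GB) = (1/2) *\<^sub>C comult casimir"
    "natural_hom (generator GC) = sl2_E \<otimes>\<^sub>C sl2_F - sl2_F \<otimes>\<^sub>C sl2_E"
    unfolding nat presented_hom_generator[OF resp] by (simp_all add: a_def b_def c_eq h1_def h2_def)
  show "commuting (comult sl2_H) (natural_hom u)"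
  proof (induction u rule: presented.abs_induct)
    case (1 t)
    have "commuting (h1 + h2) (eval_term (\<lambda>g. case g of GA \<Rightarrow> a | GB \<Rightarrow> b | GC \<Rightarrow> c) t)"
    proof (induction t)
      case (Gen g)
      then show ?case using hx' by (cases g) auto
    qed (auto intro!: commuting_intros)
    then show ?case
      unfolding nat presented_hom_abs[OF resp] algebra_hom_comult(4) h1_def h2_def .
  qed
qed

lemma clinear_cendo_apply: "clinear (cendo_apply f)"
  using cendo_apply by simp

lemmas cendo_apply_add = clinear_add[OF clinear_cendo_apply]
  and cendo_apply_scaleC = clinear_scaleC[OF clinear_cendo_apply]
  and cendo_apply_zero = clinear_zero[OF clinear_cendo_apply]

lemma cendo_tensor_pure:
  "cendo_apply (cendo_tensor f g) (v \<otimes>\<^sub>C w) = cendo_apply f v \<otimes>\<^sub>C cendo_apply g w"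
  by transfer (rule tensor_lift_pure[OF cbilinear_tensor_map])

lemma cendo_tensor_eqI:
  assumes "\<And>v w. cendo_apply f (v \<otimes>\<^sub>C w) = cendo_apply g (v \<otimes>\<^sub>C w)"
  shows "f = g"
  using tensor_clinear_eqI[OF clinear_cendo_apply clinear_cendo_apply assms]
  by (simp add: cendo_apply_inject[symmetric] fun_eq_iff)

lemma cbilinear_cendo_tensor:
  assumes "clinear \<rho>" "clinear \<sigma>"
  shows "cbilinear (\<lambda>a b. cendo_tensor (\<rho> a) (\<sigma> b))"
  by (rule cbilinearI; rule cendo_tensor_eqI)
    (simp_all add: cendo_tensor_pure plus_cendo.rep_eq scaleC_cendo.rep_eq clinear_add[OF assms(1)]
      clinear_add[OF assms(2)] clinear_scaleC[OF assms(1)] clinear_scaleC[OF assms(2)] pure_tensor_simps)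

lemma tensor_rep_pure:
  assumes "algebra_hom \<rho>" "algebra_hom \<sigma>"
  shows "tensor_rep \<rho> \<sigma> (a \<otimes>\<^sub>C b) = cendo_tensor (\<rho> a) (\<sigma> b)"
  using assms unfolding tensor_rep_def algebra_hom_def
  by (intro tensor_lift_pure cbilinear_cendo_tensor) auto

lemma algebra_hom_tensor_rep:
  assumes "algebra_hom \<rho>" "algebra_hom \<sigma>"
  shows "algebra_hom (tensor_rep \<rho> \<sigma>)"
proof -
  have lin: "clinear (tensor_rep \<rho> \<sigma>)"
    using assms unfolding tensor_rep_def algebra_hom_def
    by (intro clinear_tensor_lift cbilinear_cendo_tensor) auto
  note L = clinear_zero[OF lin] clinear_add[OF lin]
  have "tensor_rep \<rho> \<sigma> (s * t) = tensor_rep \<rho> \<sigma> s * tensor_rep \<rho> \<sigma> t" for s t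
  proof (induction s rule: tensor_induct)
    case (pure a b)
    show ?case
    proof (induction t rule: tensor_induct)
      case (pure c d)
      show ?case
        by (rule cendo_tensor_eqI)
          (simp add: tensor_rep_pure[OF assms] times_cendo.rep_eq cendo_tensor_pure
            algebra_hom_simps(6)[OF assms(1)] algebra_hom_simps(6)[OF assms(2)])
    qed (simp_all add: L ring_distribs)
  qed (simp_all add: L ring_distribs)
  moreover have "tensor_rep \<rho> \<sigma> 1 = 1"
    by (rule cendo_tensor_eqI)
      (simp add: one_tensor_def tensor_rep_pure[OF assms] one_cendo.rep_eq cendo_tensor_pure
        algebra_hom_simps(5)[OF assms(1)] algebra_hom_simps(5)[OF assms(2)])
  ultimately show ?thesis using lin by (simp add: algebra_hom_def)
qed

lemma free_vec_clinear_eqI: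
  assumes "clinear f" "clinear g" "\<And>x. f (basis_vec x) = g (basis_vec x)"
  shows "f v = g v"
  by (induction v rule: free_vec_induct)
    (simp_all add: assms clinear_zero[OF assms(1)] clinear_zero[OF assms(2)] clinear_add[OF assms(1)]
      clinear_add[OF assms(2)] clinear_scaleC[OF assms(1)] clinear_scaleC[OF assms(2)])

lemma cendo_free_vec_eqI:
  assumes "\<And>x. cendo_apply f (basis_vec x) = cendo_apply g (basis_vec x)"
  shows "f = g"
  using free_vec_clinear_eqI[OF clinear_cendo_apply clinear_cendo_apply assms]
  by (simp add: cendo_apply_inject[symmetric] fun_eq_iff)

lemma clinear_sum: "clinear f \<Longrightarrow> f (sum g A) = (\<Sum>x\<in>A. f (g x))"
  by (induction A rule: infinite_finite_induct) (simp_all add: clinear_zero clinear_add)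

lemma pow_E_eq:
  assumes "finite S" "x \<subseteq> S"
  shows "pow_E S x = (\<Sum>a\<in>x. basis_vec (x - {a}))"
proof -
  have x: "finite x" using assms finite_subset by blast
  have "{y. y \<subseteq> x \<and> card y + 1 = card x} = (\<lambda>a. x - {a}) ` x"
  proof (intro equalityI subsetI)
    fix y assume y: "y \<in> {y. y \<subseteq> x \<and> card y + 1 = card x}"
    then have "card (x - y) = card x - card y" using x by (intro card_Diff_subset) (auto intro: finite_subset)
    then have "card (x - y) = 1" using y by (auto simp: eq_commute[of _ "card x"])
    then obtain a where "x - y = {a}" by (rule card_1_singletonE)
    then show "y \<in> (\<lambda>a. x - {a}) ` x" using y by (intro image_eqI[of _ _ a]) auto
  qed (use x in \<open>auto simp: card_Suc_Diff1 simp del: card_Diff_insert card_Diff_singleton\<close>)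
  moreover have "inj_on (\<lambda>a. x - {a}) x" by (auto simp: inj_on_def)
  ultimately show ?thesis using assms by (simp add: pow_E_def sum.reindex)
qed

lemma pow_F_eq:
  assumes "finite S" "x \<subseteq> S"
  shows "pow_F S x = (\<Sum>a\<in>S - x. basis_vec (insert a x))"
proof -
  have x: "finite x" using assms finite_subset by blast
  have "{y. y \<subseteq> S \<and> x \<subseteq> y \<and> card y = card x + 1} = (\<lambda>a. insert a x) ` (S - x)"
  proof (intro equalityI subsetI)
    fix y assume y: "y \<in> {y. y \<subseteq> S \<and> x \<subseteq> y \<and> card y = card x + 1}"
    then have "card (y - x) = 1" using x by (simp add: card_Diff_subset)
    then obtain a where "y - x = {a}" by (rule card_1_singletonE)
    then show "y \<in> (\<lambda>a. insert a x) ` (S - x)" using y by (intro image_eqI[of _ _ a]) auto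
  qed (use x assms in auto)
  moreover have "inj_on (\<lambda>a. insert a x) (S - x)" by (auto simp: inj_on_def)
  ultimately show ?thesis using assms by (simp add: pow_F_def sum.reindex)
qed

lemma pow_outside: "\<not> x \<subseteq> S \<Longrightarrow> pow_E S x = 0" "\<not> x \<subseteq> S \<Longrightarrow> pow_F S x = 0" "\<not> x \<subseteq> S \<Longrightarrow> pow_H S x = 0"
  by (simp_all add: pow_E_def pow_F_def pow_H_def)

lemma sum_scaleC_const: "(\<Sum>x\<in>A. c *\<^sub>C v) = (of_nat (card A) * c) *\<^sub>C v"
  by (induction A rule: infinite_finite_induct) (simp_all add: ring_distribs scaleC_add_left)

lemma algebra_hom_pow_rep:
  assumes "finite S"
  shows "algebra_hom (pow_rep S)"
    "cendo_apply (pow_rep S sl2_E) (basis_vec x) = pow_E S x"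
    "cendo_apply (pow_rep S sl2_F) (basis_vec x) = pow_F S x"
    "cendo_apply (pow_rep S sl2_H) (basis_vec x) = pow_H S x"
proof -
  let ?E = "linear_extension (pow_E S)" and ?F = "linear_extension (pow_F S)"
    and ?H = "linear_extension (pow_H S)"
  note lin = clinear_sum[OF clinear_linear_extension] clinear_scaleC[OF clinear_linear_extension]
    clinear_zero[OF clinear_linear_extension]
  note rep = times_cendo.rep_eq minus_cendo.rep_eq scaleC_cendo.rep_eq
  have HE: "?H (pow_E S x) - ?E (pow_H S x) = 2 *\<^sub>C pow_E S x" for x
  proof (cases "x \<subseteq> S")
    case True
    then have x: "finite x" using assms finite_subset by blast
    have "pow_H S (x - {a}) = (of_nat (card S) - 2 * of_nat (card x) + 2) *\<^sub>C basis_vec (x - {a})"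
      if "a \<in> x" for a
    proof -
      have "card x = card (x - {a}) + 1" using x that
        by (metis card_Suc_Diff1 Suc_eq_plus1)
      then show ?thesis using True by (auto simp: pow_H_def)
    qed
    then have "?H (pow_E S x) = (of_nat (card S) - 2 * of_nat (card x) + 2) *\<^sub>C pow_E S x"
      using True by (simp add: pow_E_eq[OF assms] lin complex_vector.scale_sum_right)
    moreover have "?E (pow_H S x) = (of_nat (card S) - 2 * of_nat (card x)) *\<^sub>C pow_E S x"
      using True by (simp add: pow_H_def lin)
    ultimately show ?thesis by (simp flip: scaleC_diff_left)
  qed (simp add: pow_outside lin)
  have HF: "?H (pow_F S x) - ?F (pow_H S x) = (-2) *\<^sub>C pow_F S x" for x
  proof (cases "x \<subseteq> S")
    case True
    then have x: "finite x" using assms finite_subset by blast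
    have "pow_H S (insert a x) = (of_nat (card S) - 2 * of_nat (card x) - 2) *\<^sub>C basis_vec (insert a x)"
      if "a \<in> S - x" for a
      using True that x by (simp add: pow_H_def algebra_simps)
    then have "?H (pow_F S x) = (of_nat (card S) - 2 * of_nat (card x) - 2) *\<^sub>C pow_F S x"
      using True by (simp add: pow_F_eq[OF assms] lin complex_vector.scale_sum_right)
    moreover have "?F (pow_H S x) = (of_nat (card S) - 2 * of_nat (card x)) *\<^sub>C pow_F S x"
      using True by (simp add: pow_H_def lin)
    ultimately show ?thesis by (simp flip: scaleC_diff_left scaleC_minus_left)
  qed (simp add: pow_outside lin)
  have EF: "?E (pow_F S x) - ?F (pow_E S x) = pow_H S x" for x
  proof (cases "x \<subseteq> S")
    case True
    then have x: "finite x" using assms finite_subset by blast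
    have 1: "pow_E S (insert a x) = basis_vec x + (\<Sum>b\<in>x. basis_vec (insert a (x - {b})))"
      if a: "a \<in> S - x" for a
    proof -
      have "pow_E S (insert a x) = (\<Sum>b\<in>insert a x. basis_vec (insert a x - {b}))"
        using True a by (intro pow_E_eq assms) auto
      also have "\<dots> = basis_vec (insert a x - {a}) + (\<Sum>b\<in>x. basis_vec (insert a x - {b}))"
        using a x by simp
      also have "insert a x - {a} = x" using a by auto
      also have "(\<Sum>b\<in>x. basis_vec (insert a x - {b})) = (\<Sum>b\<in>x. basis_vec (insert a (x - {b})))"
        using a by (intro sum.cong refl arg_cong[where f = basis_vec]) auto
      finally show ?thesis .
    qed
    have 2: "pow_F S (x - {b}) = basis_vec x + (\<Sum>a\<in>S - x. basis_vec (insert a (x - {b})))"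
      if b: "b \<in> x" for b
    proof -
      have "pow_F S (x - {b}) = (\<Sum>a\<in>S - (x - {b}). basis_vec (insert a (x - {b})))"
        using True by (intro pow_F_eq assms) auto
      also have "S - (x - {b}) = insert b (S - x)" using b True by auto
      also have "(\<Sum>a\<in>insert b (S - x). basis_vec (insert a (x - {b}))) =
          basis_vec (insert b (x - {b})) + (\<Sum>a\<in>S - x. basis_vec (insert a (x - {b})))"
        using assms b by (intro sum.insert) auto
      also have "insert b (x - {b}) = x" using b by auto
      finally show ?thesis .
    qed
    have "?E (pow_F S x) = of_nat (card (S - x)) *\<^sub>C basis_vec x +
        (\<Sum>a\<in>S - x. \<Sum>b\<in>x. basis_vec (insert a (x - {b})))"
      using sum_scaleC_const[of 1 "basis_vec x" "S - x"]
      by (simp add: pow_F_eq[OF assms True] lin 1 sum.distrib)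
    moreover have "?F (pow_E S x) = of_nat (card x) *\<^sub>C basis_vec x +
        (\<Sum>b\<in>x. \<Sum>a\<in>S - x. basis_vec (insert a (x - {b})))"
      using sum_scaleC_const[of 1 "basis_vec x" x]
      by (simp add: pow_E_eq[OF assms True] lin 2 sum.distrib)
    moreover have "(\<Sum>a\<in>S - x. \<Sum>b\<in>x. basis_vec (insert a (x - {b}))) =
        (\<Sum>b\<in>x. \<Sum>a\<in>S - x. basis_vec (insert a (x - {b})))"
      by (rule sum.swap)
    moreover have "card (S - x) = card S - card x" "card x \<le> card S"
      using True x assms by (simp_all add: card_Diff_subset card_mono)
    ultimately show ?thesis using True
      by (simp add: pow_H_def of_nat_diff flip: scaleC_diff_left)
  qed (simp add: pow_outside lin)
  let ?e = "linear_extension_endo (pow_E S)" and ?f = "linear_extension_endo (pow_F S)"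
    and ?h = "linear_extension_endo (pow_H S)"
  have r: "?h * ?e - ?e * ?h = 2 *\<^sub>C ?e" "?h * ?f - ?f * ?h = (-2) *\<^sub>C ?f" "?e * ?f - ?f * ?e = ?h"
    by (rule cendo_free_vec_eqI, simp add: rep HE HF EF del: complex_vector.scale_minus_left)+
  note * = algebra_hom_usl2_hom[OF r, folded pow_rep_def]
  show "algebra_hom (pow_rep S)"
    "cendo_apply (pow_rep S sl2_E) (basis_vec x) = pow_E S x"
    "cendo_apply (pow_rep S sl2_F) (basis_vec x) = pow_F S x"
    "cendo_apply (pow_rep S sl2_H) (basis_vec x) = pow_H S x"
    by (simp_all add: *)
qed

lemma presented_induct [case_names gen scal add mult]:
  assumes "\<And>g. P (generator g)" "\<And>c. P (c *\<^sub>C 1)" "\<And>x y. P x \<Longrightarrow> P y \<Longrightarrow> P (x + y)"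
    "\<And>x y. P x \<Longrightarrow> P y \<Longrightarrow> P (x * y)"
  shows "P (u :: 'g::presentation presented)"
proof (induction u rule: presented.abs_induct)
  case (1 t)
  show ?case
  proof (induction t)
    case (Scal c)
    have "abs_presented (Scal c :: 'g alg_term) = c *\<^sub>C 1"
      unfolding scaleC_presented.abs_eq one_presented.abs_eq presented.abs_eq_iff
      using alg_cong.ac_scal_times[of relation c 1] by simp
    then show ?case using assms(2) by metis
  qed (use assms in \<open>simp_all flip: generator.abs_eq plus_presented.abs_eq times_presented.abs_eq\<close>)
qed

lemma span_of_closed:
  "0 \<in> span_of X" "v \<in> span_of X \<Longrightarrow> w \<in> span_of X \<Longrightarrow> v + w \<in> span_of X"
  "v \<in> span_of X \<Longrightarrow> c *\<^sub>C v \<in> span_of X" "x \<in> X \<Longrightarrow> basis_vec x \<in> span_of X"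
  using Poly_Mapping.keys_add[of v w] unfolding span_of_def
  by (auto simp: in_keys_iff scaleC_complex_def subset_iff lookup_single when_def split: if_splits)

lemma span_of_sum: "(\<And>i. i \<in> I \<Longrightarrow> f i \<in> span_of X) \<Longrightarrow> sum f I \<in> span_of X"
  by (induction I rule: infinite_finite_induct) (simp_all add: span_of_closed)

lemma span_of_induct [consumes 1, case_names zero add scale basis]:
  assumes "v \<in> span_of X" "P 0" "\<And>v w. P v \<Longrightarrow> P w \<Longrightarrow> P (v + w)"
    "\<And>c v. P v \<Longrightarrow> P (c *\<^sub>C v)" "\<And>x. x \<in> X \<Longrightarrow> P (basis_vec x)"
  shows "P v"
proof -
  have *: "P (\<Sum>x\<in>A. Poly_Mapping.lookup v x *\<^sub>C basis_vec x)" if "A \<subseteq> X" for A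
    using that by (induction A rule: infinite_finite_induct) (simp_all add: assms)
  have "P (linear_extension basis_vec v)"
    unfolding linear_extension_def by (rule *) (use assms(1) in \<open>simp add: span_of_def\<close>)
  then show ?thesis using free_vec_expansion[of v] by metis
qed

lemma pow_rep_invariant:
  assumes S: "finite S"
  shows "v \<in> span_of (Pow S) \<Longrightarrow> cendo_apply (pow_rep S u) v \<in> span_of (Pow S)"
proof (induction u arbitrary: v rule: presented_induct)
  case (gen g)
  have "cendo_apply (pow_rep S (generator g)) (basis_vec x) \<in> span_of (Pow S)" if x: "x \<subseteq> S" for x
    using x algebra_hom_pow_rep(2-4)[OF S, of x] unfolding sl2_E_def sl2_F_def sl2_H_def
    by (cases g) (auto simp: pow_E_def pow_F_def pow_H_def intro!: span_of_sum span_of_closed)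
  with gen show ?case
    by (induction rule: span_of_induct)
      (simp_all add: span_of_closed cendo_apply_add cendo_apply_scaleC cendo_apply_zero)
qed (simp_all add: algebra_hom_simps[OF algebra_hom_pow_rep(1)[OF S]] plus_cendo.rep_eq
    times_cendo.rep_eq scaleC_cendo.rep_eq one_cendo.rep_eq span_of_closed)

lemma clinear_iota: "clinear (iota x\<^sub>0)"
  unfolding iota_def by (rule clinear_linear_extension)

lemma iota_basis: "iota x\<^sub>0 (basis_vec x) = basis_vec (x - x\<^sub>0) \<otimes>\<^sub>C basis_vec (x \<inter> x\<^sub>0)"
  by (simp add: iota_def)

lemma inj_iota: "inj (iota x\<^sub>0)"
proof -
  define m :: "'a set free_vec \<Rightarrow> 'a set free_vec \<Rightarrow> 'a set free_vec"
    where "m v w = linear_extension (\<lambda>x. linear_extension (\<lambda>y. basis_vec (x \<union> y)) w) v" for v w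
  have r: "clinear (m v)" for v
    unfolding clinear_iff m_def linear_extension_def[of _ v]
    by (simp add: clinear_add[OF clinear_linear_extension] clinear_scaleC[OF clinear_linear_extension]
        scaleC_add_right sum.distrib complex_vector.scale_sum_right mult.commute)
  have l: "clinear (\<lambda>v. m v w)" for w
    unfolding m_def by (rule clinear_linear_extension)
  have m: "cbilinear m" using r l by (simp add: cbilinear_def)
  have lin: "clinear (\<lambda>v. tensor_lift m (iota x\<^sub>0 v))"
    unfolding clinear_iff
    by (simp add: clinear_add[OF clinear_tensor_lift[OF m]] clinear_add[OF clinear_iota]
        clinear_scaleC[OF clinear_tensor_lift[OF m]] clinear_scaleC[OF clinear_iota])
  have id: "clinear (\<lambda>v. v)" by (simp add: clinear_iff)
  have "tensor_lift m (iota x\<^sub>0 v) = v" for v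
    by (rule free_vec_clinear_eqI[OF lin id])
      (simp add: iota_basis tensor_lift_pure[OF m] m_def Un_Diff_Int)
  then show ?thesis by (rule inj_on_inverseI)
qed

lemma iota_image_closed:
  "s \<in> iota x\<^sub>0 ` span_of X \<Longrightarrow> t \<in> iota x\<^sub>0 ` span_of X \<Longrightarrow> s + t \<in> iota x\<^sub>0 ` span_of X"
  "s \<in> iota x\<^sub>0 ` span_of X \<Longrightarrow> c *\<^sub>C s \<in> iota x\<^sub>0 ` span_of X"
  "0 \<in> iota x\<^sub>0 ` span_of X"
  by (auto simp: span_of_closed clinear_zero[OF clinear_iota]
      simp flip: clinear_add[OF clinear_iota] clinear_scaleC[OF clinear_iota]
      intro!: imageI image_eqI[of 0 _ 0])

context
  fixes \<Omega> x\<^sub>0 :: "'a set"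
  assumes fin: "finite \<Omega>" and sub: "x\<^sub>0 \<subseteq> \<Omega>"
begin

abbreviation square_rep :: "(usl2, usl2) tensor \<Rightarrow> ('a set free_vec, 'a set free_vec) tensor cendo"
  where "square_rep \<equiv> tensor_rep (pow_rep (\<Omega> - x\<^sub>0)) (pow_rep x\<^sub>0)"

lemma finite_parts: "finite (\<Omega> - x\<^sub>0)" "finite x\<^sub>0"
  using fin sub finite_subset by auto

lemmas algebra_hom_square_rep = algebra_hom_tensor_rep[OF algebra_hom_pow_rep(1)[OF finite_parts(1)] algebra_hom_pow_rep(1)[OF finite_parts(2)]]
lemmas square_rep_pure = tensor_rep_pure[OF algebra_hom_pow_rep(1)[OF finite_parts(1)] algebra_hom_pow_rep(1)[OF finite_parts(2)]]

lemma pure_in_iota_image: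
  assumes "v \<in> span_of (Pow (\<Omega> - x\<^sub>0))" "w \<in> span_of (Pow x\<^sub>0)"
  shows "v \<otimes>\<^sub>C w \<in> iota x\<^sub>0 ` span_of (Pow \<Omega>)"
proof -
  have z: "0 \<otimes>\<^sub>C b = 0" "a \<otimes>\<^sub>C 0 = 0" for a b :: "'a set free_vec"
    using pure_tensor_scaleC_left[of 0 a b] pure_tensor_scaleC_right[of a 0 b]
      pure_tensor_scaleC_left[of 0 0 b] pure_tensor_scaleC_right[of a 0 0] by simp_all
  have b: "basis_vec x \<otimes>\<^sub>C basis_vec y \<in> iota x\<^sub>0 ` span_of (Pow \<Omega>)"
    if "x \<subseteq> \<Omega> - x\<^sub>0" "y \<subseteq> x\<^sub>0" for x y
  proof (rule image_eqI)
    have "(x \<union> y) - x\<^sub>0 = x" "(x \<union> y) \<inter> x\<^sub>0 = y" using that by auto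
    then show "basis_vec x \<otimes>\<^sub>C basis_vec y = iota x\<^sub>0 (basis_vec (x \<union> y))" by (simp add: iota_basis)
    show "basis_vec (x \<union> y) \<in> span_of (Pow \<Omega>)" using that sub by (auto intro!: span_of_closed)
  qed
  have "basis_vec x \<otimes>\<^sub>C w \<in> iota x\<^sub>0 ` span_of (Pow \<Omega>)" if "x \<subseteq> \<Omega> - x\<^sub>0" for x
    using assms(2)
    by (induction rule: span_of_induct)
      (simp_all add: z pure_tensor_simps iota_image_closed b that)
  with assms(1) show ?thesis
    by (induction rule: span_of_induct) (simp_all add: z pure_tensor_simps iota_image_closed)
qed

lemma square_rep_iota_image:
  assumes "v \<in> span_of (Pow \<Omega>)"
  shows "cendo_apply (square_rep u) (iota x\<^sub>0 v) \<in> iota x\<^sub>0 ` span_of (Pow \<Omega>)"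
proof (induction u rule: tensor_induct)
  case (pure a b)
  from assms show ?case
  proof (induction rule: span_of_induct)
    case (basis x)
    then show ?case
      by (auto simp: iota_basis square_rep_pure cendo_tensor_pure
          intro!: pure_in_iota_image pow_rep_invariant finite_parts span_of_closed)
  qed (simp_all add: clinear_zero[OF clinear_iota] clinear_add[OF clinear_iota]
      clinear_scaleC[OF clinear_iota] cendo_apply_zero cendo_apply_add cendo_apply_scaleC iota_image_closed)
qed (simp_all add: algebra_hom_simps[OF algebra_hom_square_rep] zero_cendo.rep_eq plus_cendo.rep_eq iota_image_closed)

lemma usl2_tensor_action:
  assumes "v \<in> span_of (Pow \<Omega>)"
  shows "usl2_tensor_action \<Omega> x\<^sub>0 u v \<in> span_of (Pow \<Omega>)"
    "iota x\<^sub>0 (usl2_tensor_action \<Omega> x\<^sub>0 u v) = cendo_apply (square_rep u) (iota x\<^sub>0 v)"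
  unfolding usl2_tensor_action_def
  using square_rep_iota_image[OF assms] by (rule inv_into_into, rule f_inv_into_f)

lemma usl2_tensor_action_eqI:
  assumes "v \<in> span_of (Pow \<Omega>)" "cendo_apply (square_rep u) (iota x\<^sub>0 v) = iota x\<^sub>0 w"
  shows "usl2_tensor_action \<Omega> x\<^sub>0 u v = w"
  using usl2_tensor_action(2)[OF assms(1)] assms(2) inj_iota[of x\<^sub>0] by (metis injD)

lemma comult_H_action:
  assumes "x \<subseteq> \<Omega>"
  shows "usl2_tensor_action \<Omega> x\<^sub>0 (comult sl2_H) (basis_vec x) =
    (of_nat (card \<Omega>) - 2 * of_nat (card x)) *\<^sub>C basis_vec x"
proof (rule usl2_tensor_action_eqI)
  show "basis_vec x \<in> span_of (Pow \<Omega>)" using assms by (auto intro: span_of_closed)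
  have x: "finite x" using assms fin finite_subset by blast
  have "card \<Omega> = card (\<Omega> - x\<^sub>0) + card x\<^sub>0"
    using fin finite_parts sub by (metis card_Diff_subset card_mono le_add_diff_inverse2)
  moreover have "card x = card (x - x\<^sub>0) + card (x \<inter> x\<^sub>0)"
    using x by (metis Int_Diff_Un Int_Diff_disjoint add.commute card_Un_disjoint finite_Diff finite_Int)
  ultimately have c: "of_nat (card \<Omega>) - 2 * of_nat (card x) =
      (of_nat (card (\<Omega> - x\<^sub>0)) - 2 * of_nat (card (x - x\<^sub>0))) +
      (of_nat (card x\<^sub>0) - 2 * of_nat (card (x \<inter> x\<^sub>0)) :: complex)"
    by simp
  have "x - x\<^sub>0 \<subseteq> \<Omega> - x\<^sub>0" using assms by auto
  then show "cendo_apply (square_rep (comult sl2_H)) (iota x\<^sub>0 (basis_vec x)) =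
      iota x\<^sub>0 ((of_nat (card \<Omega>) - 2 * of_nat (card x)) *\<^sub>C basis_vec x)"
    unfolding c scaleC_add_left
    by (simp add: algebra_hom_comult(4) algebra_hom_simps(1)[OF algebra_hom_square_rep] square_rep_pure plus_cendo.rep_eq
        iota_basis cendo_tensor_pure clinear_scaleC[OF clinear_iota] clinear_add[OF clinear_iota]
        algebra_hom_pow_rep(4)[OF finite_parts(1)] algebra_hom_pow_rep(4)[OF finite_parts(2)]
        algebra_hom_simps(5)[OF algebra_hom_pow_rep(1)[OF finite_parts(1)]]
        algebra_hom_simps(5)[OF algebra_hom_pow_rep(1)[OF finite_parts(2)]] one_cendo.rep_eq pow_H_def
        pure_tensor_simps)
qed

lemma usl2_tensor_action_module:
  assumes "v \<in> span_of (Pow \<Omega>)"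
  shows "w \<in> span_of (Pow \<Omega>) \<Longrightarrow>
      usl2_tensor_action \<Omega> x\<^sub>0 u (v + w) = usl2_tensor_action \<Omega> x\<^sub>0 u v + usl2_tensor_action \<Omega> x\<^sub>0 u w"
    "usl2_tensor_action \<Omega> x\<^sub>0 u (c *\<^sub>C v) = c *\<^sub>C usl2_tensor_action \<Omega> x\<^sub>0 u v"
    "usl2_tensor_action \<Omega> x\<^sub>0 (s + t) v = usl2_tensor_action \<Omega> x\<^sub>0 s v + usl2_tensor_action \<Omega> x\<^sub>0 t v"
    "usl2_tensor_action \<Omega> x\<^sub>0 (c *\<^sub>C t) v = c *\<^sub>C usl2_tensor_action \<Omega> x\<^sub>0 t v"
    "usl2_tensor_action \<Omega> x\<^sub>0 (s * t) v = usl2_tensor_action \<Omega> x\<^sub>0 s (usl2_tensor_action \<Omega> x\<^sub>0 t v)"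
    "usl2_tensor_action \<Omega> x\<^sub>0 1 v = v"
  by (rule usl2_tensor_action_eqI;
      simp add: assms span_of_closed usl2_tensor_action clinear_add[OF clinear_iota]
        clinear_scaleC[OF clinear_iota] cendo_apply_add cendo_apply_scaleC algebra_hom_simps[OF algebra_hom_square_rep]
        plus_cendo.rep_eq times_cendo.rep_eq scaleC_cendo.rep_eq one_cendo.rep_eq)+

lemma johnson_space_eigenspace:
  "johnson_space \<Omega> k = {v \<in> span_of (Pow \<Omega>). usl2_tensor_action \<Omega> x\<^sub>0 (comult sl2_H) v =
     (of_nat (card \<Omega>) - 2 * of_nat k) *\<^sub>C v}"
proof -
  let ?c = "\<lambda>x. of_nat (card \<Omega>) - 2 * of_nat (card x) :: complex"
  have *: "Poly_Mapping.lookup (usl2_tensor_action \<Omega> x\<^sub>0 (comult sl2_H) v) x = ?c x * Poly_Mapping.lookup v x"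
    if "v \<in> span_of (Pow \<Omega>)" for v x
    using that
  proof -
    from that have "v \<in> span_of (Pow \<Omega>) \<and>
      Poly_Mapping.lookup (usl2_tensor_action \<Omega> x\<^sub>0 (comult sl2_H) v) x = ?c x * Poly_Mapping.lookup v x"
    proof (induction rule: span_of_induct)
      case zero
      then show ?case
        using usl2_tensor_action_module(2)[of 0 _ 0] by (simp add: span_of_closed)
    next
      case (basis y)
      then show ?case by (auto simp: comult_H_action span_of_closed lookup_single when_def scaleC_complex_def)
    next
      case (scale c v)
      then show ?case
        by (simp add: span_of_closed usl2_tensor_action_module scaleC_complex_def mult.left_commute)
    qed (simp_all add: span_of_closed usl2_tensor_action_module lookup_add ring_distribs)
    then show ?thesis ..
  qed
  show ?thesis
  proof (intro equalityI subsetI)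
    fix v assume "v \<in> johnson_space \<Omega> k"
    then have v: "Poly_Mapping.keys v \<subseteq> nsets \<Omega> k" by (simp add: johnson_space_def span_of_def)
    then have v': "v \<in> span_of (Pow \<Omega>)" by (auto simp: span_of_def nsets_def)
    have "usl2_tensor_action \<Omega> x\<^sub>0 (comult sl2_H) v = (of_nat (card \<Omega>) - 2 * of_nat k) *\<^sub>C v"
    proof (rule poly_mapping_eqI)
      fix x
      show "Poly_Mapping.lookup (usl2_tensor_action \<Omega> x\<^sub>0 (comult sl2_H) v) x =
          Poly_Mapping.lookup ((of_nat (card \<Omega>) - 2 * of_nat k) *\<^sub>C v) x"
        using v by (cases "x \<in> Poly_Mapping.keys v")
          (auto simp: *[OF v'] scaleC_complex_def in_keys_iff nsets_def)
    qed
    then show "v \<in> {v \<in> span_of (Pow \<Omega>). usl2_tensor_action \<Omega> x\<^sub>0 (comult sl2_H) v =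
        (of_nat (card \<Omega>) - 2 * of_nat k) *\<^sub>C v}" using v' by simp
  next
    fix v assume v: "v \<in> {v \<in> span_of (Pow \<Omega>). usl2_tensor_action \<Omega> x\<^sub>0 (comult sl2_H) v =
        (of_nat (card \<Omega>) - 2 * of_nat k) *\<^sub>C v}"
    have "x \<in> nsets \<Omega> k" if x: "x \<in> Poly_Mapping.keys v" for x
    proof -
      have "?c x * Poly_Mapping.lookup v x = (of_nat (card \<Omega>) - 2 * of_nat k) * Poly_Mapping.lookup v x"
        using v *[of v x] by (auto simp: scaleC_complex_def)
      then have "card x = k" using x by (auto simp: in_keys_iff)
      moreover have "x \<subseteq> \<Omega>" using v x by (auto simp: span_of_def)
      ultimately show ?thesis using fin finite_subset by (auto simp: nsets_def)
    qed
    then show "v \<in> johnson_space \<Omega> k" by (auto simp: johnson_space_def span_of_def)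
  qed
qed

lemma johnson_space_subset: "v \<in> johnson_space \<Omega> k \<Longrightarrow> v \<in> span_of (Pow \<Omega>)"
  by (simp add: johnson_space_eigenspace)

lemma johnson_space_invariant:
  assumes "v \<in> johnson_space \<Omega> k"
  shows "hahn_action \<Omega> x\<^sub>0 u v \<in> johnson_space \<Omega> k"
proof -
  have v: "v \<in> span_of (Pow \<Omega>)" using assms by (rule johnson_space_subset)
  have "usl2_tensor_action \<Omega> x\<^sub>0 (comult sl2_H) (hahn_action \<Omega> x\<^sub>0 u v) =
      usl2_tensor_action \<Omega> x\<^sub>0 (natural_hom u) (usl2_tensor_action \<Omega> x\<^sub>0 (comult sl2_H) v)"
    using algebra_hom_natural_hom(5)[of u] usl2_tensor_action_module(5)[OF v]
    unfolding commuting_def hahn_action_def by metis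
  also have "\<dots> = (of_nat (card \<Omega>) - 2 * of_nat k) *\<^sub>C hahn_action \<Omega> x\<^sub>0 u v"
    using assms usl2_tensor_action_module(2)[OF v]
    by (simp add: johnson_space_eigenspace hahn_action_def)
  finally show ?thesis
    using usl2_tensor_action(1)[OF v] by (simp add: johnson_space_eigenspace hahn_action_def)
qed

text \<open>\<^term>\<open>hahn_rep \<Omega> k x\<^sub>0\<close> is a homomorphism into the endomorphism algebra of
  \<^term>\<open>johnson_space \<Omega> k\<close>.\<close>

lemma hahn_rep_representation:
  "hahn_rep \<Omega> k x\<^sub>0 u \<in> End_on (johnson_space \<Omega> k)"
  "hahn_rep \<Omega> k x\<^sub>0 1 = (\<lambda>v\<in>johnson_space \<Omega> k. v)"
  "hahn_rep \<Omega> k x\<^sub>0 (s + t) = (\<lambda>v\<in>johnson_space \<Omega> k. hahn_rep \<Omega> k x\<^sub>0 s v + hahn_rep \<Omega> k x\<^sub>0 t v)"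
  "hahn_rep \<Omega> k x\<^sub>0 (c *\<^sub>C t) = (\<lambda>v\<in>johnson_space \<Omega> k. c *\<^sub>C hahn_rep \<Omega> k x\<^sub>0 t v)"
  "hahn_rep \<Omega> k x\<^sub>0 (s * t) = compose (johnson_space \<Omega> k) (hahn_rep \<Omega> k x\<^sub>0 s) (hahn_rep \<Omega> k x\<^sub>0 t)"
proof -
  note J = johnson_space_subset
  have cl: "v \<in> johnson_space \<Omega> k \<Longrightarrow> w \<in> johnson_space \<Omega> k \<Longrightarrow> v + w \<in> johnson_space \<Omega> k"
    "v \<in> johnson_space \<Omega> k \<Longrightarrow> a *\<^sub>C v \<in> johnson_space \<Omega> k" for v w a
    by (simp_all add: johnson_space_def span_of_closed)
  show "hahn_rep \<Omega> k x\<^sub>0 u \<in> End_on (johnson_space \<Omega> k)"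
    unfolding End_on_def hahn_rep_def
    using johnson_space_invariant cl usl2_tensor_action_module(1)[OF J J] usl2_tensor_action_module(2)[OF J]
    by (auto simp: hahn_action_def)
  show "hahn_rep \<Omega> k x\<^sub>0 1 = (\<lambda>v\<in>johnson_space \<Omega> k. v)"
    unfolding hahn_rep_def hahn_action_def algebra_hom_simps[OF algebra_hom_natural_hom(1)]
    by (rule restrict_ext) (use usl2_tensor_action_module(6)[OF J] in blast)
  show "hahn_rep \<Omega> k x\<^sub>0 (s + t) = (\<lambda>v\<in>johnson_space \<Omega> k. hahn_rep \<Omega> k x\<^sub>0 s v + hahn_rep \<Omega> k x\<^sub>0 t v)"
    unfolding hahn_rep_def hahn_action_def algebra_hom_simps[OF algebra_hom_natural_hom(1)]
    by (rule restrict_ext) (use usl2_tensor_action_module(3)[OF J] in simp)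
  show "hahn_rep \<Omega> k x\<^sub>0 (c *\<^sub>C t) = (\<lambda>v\<in>johnson_space \<Omega> k. c *\<^sub>C hahn_rep \<Omega> k x\<^sub>0 t v)"
    unfolding hahn_rep_def hahn_action_def algebra_hom_simps[OF algebra_hom_natural_hom(1)]
    by (rule restrict_ext) (use usl2_tensor_action_module(4)[OF J] in simp)
  show "hahn_rep \<Omega> k x\<^sub>0 (s * t) = compose (johnson_space \<Omega> k) (hahn_rep \<Omega> k x\<^sub>0 s) (hahn_rep \<Omega> k x\<^sub>0 t)"
    unfolding compose_def
    unfolding hahn_rep_def hahn_action_def algebra_hom_simps[OF algebra_hom_natural_hom(1)]
    by (rule restrict_ext)
      (use usl2_tensor_action_module(5)[OF J] johnson_space_invariant[unfolded hahn_action_def] in simp)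
qed

end

end

theory Submission
  imports Defs
begin

text \<open>On the span of the \<open>k\<close>-subsets, the generator \<open>A\<close> of the Hahn algebra is diagonal with
  eigenvalue \<open>D/4 - |x - x\<^sub>0|\<close>, so it is an affine function of the dual adjacency operator. Through
  \<open>\<iota>\<close> the coproduct becomes the usual action of \<open>sl\<^sub>2\<close> on the power set of \<open>\<Omega>\<close>, and there
  \<open>FE = k + \<^bold>A\<close>; hence \<open>B\<close>, half the Casimir element, differs from \<open>\<^bold>A\<close> by a scalar. Since
  \<open>C = [A, B]\<close>, the two pairs of operators generate the same algebra.\<close>

section \<open>The commutator relation, and the Casimir element on \<open>k\<close>-subsets\<close>

lemma hahn_generator_C:
  "generator GC = generator GA * generator GB - generator GB * (generator GA :: hahn)"
  by (transfer, rule alg_cong.ac_sym, rule alg_cong.ac_rel, rule relation_hahn_gen.intros)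

text \<open>A neighbour \<open>y\<close> of \<open>x\<close> in the Johnson graph is an exchange of
  one element \<open>b\<close> of \<open>x\<close> for one element \<open>a\<close> outside. The
  pair can be recovered from \<open>y\<close>: \<open>b\<close> is the only element of
  \<open>x - y\<close> and \<open>a\<close> the only element of \<open>y - x\<close>. This lets the
  double sum produced by \<open>FE\<close> be read as the adjacency sum.\<close>

lemma johnson_neighbours:
  assumes "finite \<Omega>" "x \<in> nsets \<Omega> k"
  shows "bij_betw (\<lambda>(b, a). insert a (x - {b})) (x \<times> (\<Omega> - x))
    {y. y \<in> nsets \<Omega> k \<and> card (x \<inter> y) + 1 = k}"
proof (rule bij_betw_imageI)
  have x: "finite x" "x \<subseteq> \<Omega>" "card x = k" using assms(2) by (auto simp: nsets_def)
  show "inj_on (\<lambda>(b, a). insert a (x - {b})) (x \<times> (\<Omega> - x))"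
  proof (rule inj_onI, clarsimp)
    fix a b a' b' assume *: "b \<in> x" "a \<notin> x" "b' \<in> x" "a' \<notin> x" "insert a (x - {b}) = insert a' (x - {b'})"
    have "x - insert a (x - {b}) = {b}" "x - insert a' (x - {b'}) = {b'}"
      "insert a (x - {b}) - x = {a}" "insert a' (x - {b'}) - x = {a'}"
      using * by blast+
    then show "b = b' \<and> a = a'" using *(5) by auto
  qed
  show "(\<lambda>(b, a). insert a (x - {b})) ` (x \<times> (\<Omega> - x)) = {y. y \<in> nsets \<Omega> k \<and> card (x \<inter> y) + 1 = k}"
  proof (intro equalityI subsetI)
    fix y assume "y \<in> (\<lambda>(b, a). insert a (x - {b})) ` (x \<times> (\<Omega> - x))"
    then obtain a b where ab: "b \<in> x" "a \<in> \<Omega> - x" "y = insert a (x - {b})" by auto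
    then have "x \<inter> y = x - {b}" by auto
    moreover have "card (x - {b}) + 1 = k" using x ab by (metis Suc_eq_plus1 card_Suc_Diff1)
    ultimately show "y \<in> {y. y \<in> nsets \<Omega> k \<and> card (x \<inter> y) + 1 = k}"
      using x ab by (auto simp: nsets_def)
  next
    fix y assume "y \<in> {y. y \<in> nsets \<Omega> k \<and> card (x \<inter> y) + 1 = k}"
    then have y: "finite y" "y \<subseteq> \<Omega>" "card y = k" and i: "card (x \<inter> y) + 1 = k"
      by (auto simp: nsets_def)
    have "card (x - y) = 1" "card (y - x) = 1"
      using x y i by (simp_all add: card_Diff_subset_Int Int_commute)
    then obtain a b where ab: "x - y = {b}" "y - x = {a}" by (meson card_1_singletonE)
    then have "y = insert a (x - {b})" "(b, a) \<in> x \<times> (\<Omega> - x)" using y by auto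
    then show "y \<in> (\<lambda>(b, a). insert a (x - {b})) ` (x \<times> (\<Omega> - x))" by force
  qed
qed

text \<open>After \<open>E\<close> removes \<open>b\<close>, \<open>F\<close> either puts
  \<open>b\<close> back, which gives \<open>x\<close> once for each of the \<open>k\<close> choices
  of \<open>b\<close>, or inserts some \<open>a\<close> outside \<open>x\<close>, which gives each
  neighbour of \<open>x\<close> exactly once.\<close>

lemma pow_rep_FE:
  assumes "finite \<Omega>" "x \<in> nsets \<Omega> k"
  shows "cendo_apply (pow_rep \<Omega> (sl2_F * sl2_E)) (basis_vec x) =
    of_nat k *\<^sub>C basis_vec x + (\<Sum>y | y \<in> nsets \<Omega> k \<and> card (x \<inter> y) + 1 = k. basis_vec y)"
proof -
  have x: "finite x" "x \<subseteq> \<Omega>" "card x = k" using assms(2) by (auto simp: nsets_def)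
  have "pow_F \<Omega> (x - {b}) = basis_vec x + (\<Sum>a\<in>\<Omega> - x. basis_vec (insert a (x - {b})))"
    if b: "b \<in> x" for b
  proof -
    have "pow_F \<Omega> (x - {b}) = (\<Sum>a\<in>\<Omega> - (x - {b}). basis_vec (insert a (x - {b})))"
      using x by (intro pow_F_eq assms) auto
    also have "\<Omega> - (x - {b}) = insert b (\<Omega> - x)" using b x by auto
    finally show ?thesis using assms b by (simp add: insert_absorb)
  qed
  then have "cendo_apply (pow_rep \<Omega> (sl2_F * sl2_E)) (basis_vec x) =
      of_nat k *\<^sub>C basis_vec x + (\<Sum>b\<in>x. \<Sum>a\<in>\<Omega> - x. basis_vec (insert a (x - {b})))"
    using x sum_scaleC_const[of 1 "basis_vec x" x]
    by (simp add: algebra_hom_simps[OF algebra_hom_pow_rep(1)] times_cendo.rep_eq assms(1)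
        algebra_hom_pow_rep pow_E_eq clinear_sum[OF clinear_cendo_apply] sum.distrib)
  then show ?thesis
    using sum.reindex_bij_betw[OF johnson_neighbours[OF assms], of basis_vec]
    by (simp add: sum.cartesian_product split_def)
qed

text \<open>The relation EF = FE + H turns the Casimir element into 2FE + H + H^2/2. With D the size
  of \<open>\<Omega>\<close>, \<open>H\<close> is the scalar D - 2k on \<open>k\<close>-subsets; its
  -2k cancels the diagonal 2k of 2FE, so only D and the square term remain.\<close>

lemma pow_rep_casimir:
  assumes "finite \<Omega>" "x \<in> nsets \<Omega> k"
  shows "cendo_apply (pow_rep \<Omega> casimir) (basis_vec x) =
    2 *\<^sub>C (\<Sum>y | y \<in> nsets \<Omega> k \<and> card (x \<inter> y) + 1 = k. basis_vec y) +
    (of_nat (card \<Omega>) + (of_nat (card \<Omega>) - 2 * of_nat k)\<^sup>2 / 2) *\<^sub>C basis_vec x"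
proof -
  have x: "finite x" "x \<subseteq> \<Omega>" "card x = k" using assms(2) by (auto simp: nsets_def)
  have EF: "sl2_E * sl2_F = sl2_F * sl2_E + sl2_H"
    using usl2_relations(3) by (simp add: diff_eq_eq add.commute)
  have cas: "casimir = 2 *\<^sub>C (sl2_F * sl2_E) + sl2_H + (1/2) *\<^sub>C (sl2_H * sl2_H)"
    unfolding casimir_def EF power2_eq_square
    using scaleC_add_left[of 1 1 "sl2_F * sl2_E"] by (simp add: algebra_simps)
  note hom = algebra_hom_simps[OF algebra_hom_pow_rep(1)[OF assms(1)]]
  have H: "cendo_apply (pow_rep \<Omega> sl2_H) (basis_vec x) =
      (of_nat (card \<Omega>) - 2 * of_nat k) *\<^sub>C basis_vec x"
    using x by (simp add: algebra_hom_pow_rep(4)[OF assms(1)] pow_H_def)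
  have "cendo_apply (pow_rep \<Omega> casimir) (basis_vec x) =
      2 *\<^sub>C cendo_apply (pow_rep \<Omega> (sl2_F * sl2_E)) (basis_vec x) +
      (of_nat (card \<Omega>) - 2 * of_nat k) *\<^sub>C basis_vec x +
      ((of_nat (card \<Omega>) - 2 * of_nat k)\<^sup>2 / 2) *\<^sub>C basis_vec x"
    unfolding cas
    by (simp add: hom(1,7) hom(6)[of sl2_H sl2_H] plus_cendo.rep_eq scaleC_cendo.rep_eq
        times_cendo.rep_eq H cendo_apply_scaleC power2_eq_square)
  then show ?thesis
    by (simp add: pow_rep_FE[OF assms] scaleC_add_right scaleC_add_left scaleC_diff_left)
qed

section \<open>The coproduct transported through \<open>iota\<close>\<close>

context
  fixes \<Omega> x\<^sub>0 :: "'a set"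
  assumes fin: "finite \<Omega>" and sub: "x\<^sub>0 \<subseteq> \<Omega>"
begin

text \<open>The element that is removed or inserted lies either outside \<open>x\<^sub>0\<close> or
  inside it, and accordingly changes only the left or only the right tensor factor. Splitting the
  sum this way gives exactly the shape X (x) 1 + 1 (x) X of the coproduct.\<close>

lemma iota_pow:
  assumes "x \<subseteq> \<Omega>"
  shows "iota x\<^sub>0 (pow_E \<Omega> x) = pow_E (\<Omega> - x\<^sub>0) (x - x\<^sub>0) \<otimes>\<^sub>C basis_vec (x \<inter> x\<^sub>0) +
      basis_vec (x - x\<^sub>0) \<otimes>\<^sub>C pow_E x\<^sub>0 (x \<inter> x\<^sub>0)"
    and "iota x\<^sub>0 (pow_F \<Omega> x) = pow_F (\<Omega> - x\<^sub>0) (x - x\<^sub>0) \<otimes>\<^sub>C basis_vec (x \<inter> x\<^sub>0) +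
      basis_vec (x - x\<^sub>0) \<otimes>\<^sub>C pow_F x\<^sub>0 (x \<inter> x\<^sub>0)"
proof -
  note parts = finite_parts[OF fin sub]
  have x: "finite x" using assms fin finite_subset by blast
  have sub': "x - x\<^sub>0 \<subseteq> \<Omega> - x\<^sub>0" "x \<inter> x\<^sub>0 \<subseteq> x\<^sub>0" using assms by auto
  have L: "clinear (\<lambda>v. v \<otimes>\<^sub>C w)" and R: "clinear ((\<otimes>\<^sub>C) w)" for w :: "'a set free_vec"
    using cbilinear_pure_tensor by (auto simp: cbilinear_def)
  let ?i = "\<lambda>y. basis_vec (y - x\<^sub>0) \<otimes>\<^sub>C basis_vec (y \<inter> x\<^sub>0)"
  have "(\<Sum>a\<in>x. ?i (x - {a})) = (\<Sum>a\<in>x - x\<^sub>0. ?i (x - {a})) + (\<Sum>a\<in>x \<inter> x\<^sub>0. ?i (x - {a}))"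
    using x by (subst sum.union_disjoint[symmetric]) (auto intro!: sum.cong)
  also have "(\<Sum>a\<in>x - x\<^sub>0. ?i (x - {a})) =
      (\<Sum>a\<in>x - x\<^sub>0. basis_vec (x - x\<^sub>0 - {a}) \<otimes>\<^sub>C basis_vec (x \<inter> x\<^sub>0))"
    by (intro sum.cong refl arg_cong2[where f = "\<lambda>u v. basis_vec u \<otimes>\<^sub>C basis_vec v"]) auto
  also have "(\<Sum>a\<in>x \<inter> x\<^sub>0. ?i (x - {a})) =
      (\<Sum>a\<in>x \<inter> x\<^sub>0. basis_vec (x - x\<^sub>0) \<otimes>\<^sub>C basis_vec (x \<inter> x\<^sub>0 - {a}))"
    by (intro sum.cong refl arg_cong2[where f = "\<lambda>u v. basis_vec u \<otimes>\<^sub>C basis_vec v"]) auto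
  finally show "iota x\<^sub>0 (pow_E \<Omega> x) = pow_E (\<Omega> - x\<^sub>0) (x - x\<^sub>0) \<otimes>\<^sub>C basis_vec (x \<inter> x\<^sub>0) +
      basis_vec (x - x\<^sub>0) \<otimes>\<^sub>C pow_E x\<^sub>0 (x \<inter> x\<^sub>0)"
    by (simp add: pow_E_eq[OF fin assms] pow_E_eq[OF parts(1) sub'(1)] pow_E_eq[OF parts(2) sub'(2)]
        clinear_sum[OF clinear_iota] clinear_sum[OF L] clinear_sum[OF R] iota_basis)
  have "(\<Sum>a\<in>\<Omega> - x. ?i (insert a x)) =
      (\<Sum>a\<in>\<Omega> - x\<^sub>0 - (x - x\<^sub>0). ?i (insert a x)) + (\<Sum>a\<in>x\<^sub>0 - x \<inter> x\<^sub>0. ?i (insert a x))"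
    using fin parts sub by (subst sum.union_disjoint[symmetric]) (auto intro!: sum.cong)
  also have "(\<Sum>a\<in>\<Omega> - x\<^sub>0 - (x - x\<^sub>0). ?i (insert a x)) =
      (\<Sum>a\<in>\<Omega> - x\<^sub>0 - (x - x\<^sub>0). basis_vec (insert a (x - x\<^sub>0)) \<otimes>\<^sub>C basis_vec (x \<inter> x\<^sub>0))"
    by (intro sum.cong refl arg_cong2[where f = "\<lambda>u v. basis_vec u \<otimes>\<^sub>C basis_vec v"]) auto
  also have "(\<Sum>a\<in>x\<^sub>0 - x \<inter> x\<^sub>0. ?i (insert a x)) =
      (\<Sum>a\<in>x\<^sub>0 - x \<inter> x\<^sub>0. basis_vec (x - x\<^sub>0) \<otimes>\<^sub>C basis_vec (insert a (x \<inter> x\<^sub>0)))"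
    by (intro sum.cong refl arg_cong2[where f = "\<lambda>u v. basis_vec u \<otimes>\<^sub>C basis_vec v"]) auto
  finally show "iota x\<^sub>0 (pow_F \<Omega> x) = pow_F (\<Omega> - x\<^sub>0) (x - x\<^sub>0) \<otimes>\<^sub>C basis_vec (x \<inter> x\<^sub>0) +
      basis_vec (x - x\<^sub>0) \<otimes>\<^sub>C pow_F x\<^sub>0 (x \<inter> x\<^sub>0)"
    by (simp add: pow_F_eq[OF fin assms] pow_F_eq[OF parts(1) sub'(1)] pow_F_eq[OF parts(2) sub'(2)]
        clinear_sum[OF clinear_iota] clinear_sum[OF L] clinear_sum[OF R] iota_basis)
qed

text \<open>\<open>a\<close> and \<open>b\<close> are kept independent because two cases occur
  later: equal elements for the coproducts of \<open>E\<close> and \<open>F\<close>, and opposite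
  ones for the generator \<open>A\<close>. Since \<open>iota\<close> is injective, the result may be
  checked after applying it.\<close>

lemma usl2_tensor_action_pure_sum:
  assumes "x \<subseteq> \<Omega>"
    "iota x\<^sub>0 w = cendo_apply (pow_rep (\<Omega> - x\<^sub>0) a) (basis_vec (x - x\<^sub>0)) \<otimes>\<^sub>C basis_vec (x \<inter> x\<^sub>0) +
      basis_vec (x - x\<^sub>0) \<otimes>\<^sub>C cendo_apply (pow_rep x\<^sub>0 b) (basis_vec (x \<inter> x\<^sub>0))"
  shows "usl2_tensor_action \<Omega> x\<^sub>0 (a \<otimes>\<^sub>C 1 + 1 \<otimes>\<^sub>C b) (basis_vec x) = w"
proof (rule usl2_tensor_action_eqI[OF fin sub])
  show "basis_vec x \<in> span_of (Pow \<Omega>)" using assms(1) by (simp add: span_of_closed)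
  show "cendo_apply (square_rep \<Omega> x\<^sub>0 (a \<otimes>\<^sub>C 1 + 1 \<otimes>\<^sub>C b)) (iota x\<^sub>0 (basis_vec x)) = iota x\<^sub>0 w"
    by (simp add: assms(2) iota_basis algebra_hom_simps(1)[OF algebra_hom_square_rep[OF fin sub]]
        square_rep_pure[OF fin sub] plus_cendo.rep_eq cendo_tensor_pure one_cendo.rep_eq
        algebra_hom_simps(5)[OF algebra_hom_pow_rep(1)[OF finite_parts(1)[OF fin sub]]]
        algebra_hom_simps(5)[OF algebra_hom_pow_rep(1)[OF finite_parts(2)[OF fin sub]]])
qed

text \<open>Both sides respect sums, products and scalars in \<open>u\<close>, so the three
  generators suffice. The vector \<open>v\<close> stays arbitrary because the product case applies
  the hypothesis for the left factor to the image of \<open>v\<close> under the right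
  factor.\<close>

lemma comult_action:
  "v \<in> span_of (Pow \<Omega>) \<Longrightarrow> usl2_tensor_action \<Omega> x\<^sub>0 (comult u) v = cendo_apply (pow_rep \<Omega> u) v"
proof (induction u arbitrary: v rule: presented_induct)
  case (gen g)
  note M = usl2_tensor_action_module[OF fin sub]
  note parts = finite_parts[OF fin sub]
  have b: "usl2_tensor_action \<Omega> x\<^sub>0 (comult (generator g)) (basis_vec x) =
      cendo_apply (pow_rep \<Omega> (generator g)) (basis_vec x)" if x: "x \<subseteq> \<Omega>" for x
  proof (cases g)
    case GE
    have "usl2_tensor_action \<Omega> x\<^sub>0 (comult sl2_E) (basis_vec x) = pow_E \<Omega> x"
      unfolding algebra_hom_comult
      by (rule usl2_tensor_action_pure_sum[OF x])
        (simp add: iota_pow[OF x] algebra_hom_pow_rep(2) parts)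
    then show ?thesis by (simp add: GE algebra_hom_pow_rep(2)[OF fin] flip: sl2_E_def)
  next
    case GF
    have "usl2_tensor_action \<Omega> x\<^sub>0 (comult sl2_F) (basis_vec x) = pow_F \<Omega> x"
      unfolding algebra_hom_comult
      by (rule usl2_tensor_action_pure_sum[OF x])
        (simp add: iota_pow[OF x] algebra_hom_pow_rep(3) parts)
    then show ?thesis by (simp add: GF algebra_hom_pow_rep(3)[OF fin] flip: sl2_F_def)
  next
    case GH
    then show ?thesis
      using x by (simp add: algebra_hom_pow_rep(4)[OF fin] comult_H_action[OF fin sub] pow_H_def
          flip: sl2_H_def)
  qed
  \<comment> \<open>Membership is carried through the induction because the transported action is
    known to be linear only on \<open>span_of (Pow \<Omega>)\<close>.\<close>
  from gen have "v \<in> span_of (Pow \<Omega>) \<and> usl2_tensor_action \<Omega> x\<^sub>0 (comult (generator g)) v =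
      cendo_apply (pow_rep \<Omega> (generator g)) v"
  proof (induction rule: span_of_induct)
    case zero
    then show ?case
      using M(2)[of 0 _ 0] by (simp add: span_of_closed cendo_apply_zero)
  qed (simp_all add: span_of_closed M cendo_apply_add cendo_apply_scaleC b)
  then show ?case ..
qed (simp_all add: algebra_hom_simps[OF algebra_hom_pow_rep(1)[OF fin]] plus_cendo.rep_eq
    algebra_hom_simps[OF algebra_hom_comult(1)] usl2_tensor_action_module[OF fin sub]
    times_cendo.rep_eq scaleC_cendo.rep_eq one_cendo.rep_eq pow_rep_invariant[OF fin])

section \<open>The Hahn generators and the two adjacency operators on
  \<open>k\<close>-subsets\<close>

lemma hahn_action_B:
  assumes "x \<in> nsets \<Omega> k"
  shows "hahn_action \<Omega> x\<^sub>0 (generator GB) (basis_vec x) =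
    (\<Sum>y | y \<in> nsets \<Omega> k \<and> card (x \<inter> y) + 1 = k. basis_vec y) +
    (of_nat (card \<Omega>) / 2 + (of_nat (card \<Omega>) - 2 * of_nat k)\<^sup>2 / 4) *\<^sub>C basis_vec x"
proof -
  have "basis_vec x \<in> span_of (Pow \<Omega>)" using assms by (auto simp: nsets_def intro: span_of_closed)
  then show ?thesis
    unfolding hahn_action_def algebra_hom_natural_hom
    by (simp add: usl2_tensor_action_module(4)[OF fin sub] comult_action
        pow_rep_casimir[OF fin assms] scaleC_add_right add_divide_distrib)
qed

text \<open>Put m = |x - \<open>x\<^sub>0\<close>|. As \<open>x\<close> and \<open>x\<^sub>0\<close>
  both have size k, the intersection has size k - m, and the two weights D - k - 2m and k - 2(k - m)
  differ by D - 4m.\<close>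

lemma hahn_action_A:
  assumes "x \<in> nsets \<Omega> k" "card x\<^sub>0 = k"
  shows "hahn_action \<Omega> x\<^sub>0 (generator GA) (basis_vec x) =
    (of_nat (card \<Omega>) / 4 - of_nat (card (x - x\<^sub>0))) *\<^sub>C basis_vec x"
proof -
  note parts = finite_parts[OF fin sub]
  have x: "finite x" "x \<subseteq> \<Omega>" "card x = k" using assms(1) by (auto simp: nsets_def)
  have c: "card \<Omega> = card (\<Omega> - x\<^sub>0) + k"
    using fin parts sub assms(2) by (metis card_Diff_subset card_mono le_add_diff_inverse2)
  have k: "k = card (x - x\<^sub>0) + card (x \<inter> x\<^sub>0)"
    using x by (metis Int_Diff_Un Int_Diff_disjoint add.commute card_Un_disjoint finite_Diff finite_Int)
  let ?p = "of_nat (card (\<Omega> - x\<^sub>0)) - 2 * of_nat (card (x - x\<^sub>0)) :: complex"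
  let ?q = "of_nat k - 2 * of_nat (card (x \<inter> x\<^sub>0)) :: complex"
  \<comment> \<open>The sign is moved into the second tensor factor so that the difference has the
    form a (x) 1 + 1 (x) b.\<close>
  have "usl2_tensor_action \<Omega> x\<^sub>0 (sl2_H \<otimes>\<^sub>C 1 + 1 \<otimes>\<^sub>C (- sl2_H)) (basis_vec x) =
      (?p - ?q) *\<^sub>C basis_vec x"
  proof (rule usl2_tensor_action_pure_sum[OF x(2)])
    have s: "x - x\<^sub>0 \<subseteq> \<Omega> - x\<^sub>0" "x \<inter> x\<^sub>0 \<subseteq> x\<^sub>0" using x by auto
    show "iota x\<^sub>0 ((?p - ?q) *\<^sub>C basis_vec x) =
        cendo_apply (pow_rep (\<Omega> - x\<^sub>0) sl2_H) (basis_vec (x - x\<^sub>0)) \<otimes>\<^sub>C basis_vec (x \<inter> x\<^sub>0) +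
        basis_vec (x - x\<^sub>0) \<otimes>\<^sub>C cendo_apply (pow_rep x\<^sub>0 (- sl2_H)) (basis_vec (x \<inter> x\<^sub>0))"
      using s by (simp add: clinear_scaleC[OF clinear_iota] iota_basis algebra_hom_pow_rep(4) parts pow_H_def
          algebra_hom_simps(3)[OF algebra_hom_pow_rep(1)] uminus_cendo.rep_eq assms(2)
          pure_tensor_simps scaleC_diff_left clinear_diff[OF clinear_iota]
          pure_tensor_diff_left pure_tensor_diff_right)
  qed
  moreover have "?p - ?q = 4 * (of_nat (card \<Omega>) / 4 - of_nat (card (x - x\<^sub>0)))"
  proof -
    have "of_nat k = (of_nat (card (x - x\<^sub>0)) + of_nat (card (x \<inter> x\<^sub>0)) :: complex)"
      by (subst k) simp
    then show ?thesis by (simp add: c)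
  qed
  moreover have "basis_vec x \<in> span_of (Pow \<Omega>)" using x by (auto intro: span_of_closed)
  ultimately show ?thesis
    unfolding hahn_action_def algebra_hom_natural_hom
    by (simp add: usl2_tensor_action_module(4)[OF fin sub] pure_tensor_minus_right)
qed

text \<open>Reduces an identity of operators on the whole span to its values on the
  \<open>k\<close>-subsets; both adjacency operators are defined as restricted linear extensions and
  are compared with the representation this way.\<close>

lemma hahn_rep_eq_linear_extension:
  assumes "\<And>x. x \<in> nsets \<Omega> k \<Longrightarrow> hahn_action \<Omega> x\<^sub>0 u (basis_vec x) = f x"
  shows "hahn_rep \<Omega> k x\<^sub>0 u = restrict (linear_extension f) (johnson_space \<Omega> k)"
  unfolding hahn_rep_def
proof (rule restrict_ext)
  fix v assume "v \<in> johnson_space \<Omega> k"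
  then have "v \<in> span_of (nsets \<Omega> k)" by (simp add: johnson_space_def)
  note M = usl2_tensor_action_module[OF fin sub]
  note L = clinear_linear_extension[of f]
  from \<open>v \<in> span_of (nsets \<Omega> k)\<close>
  have "v \<in> span_of (Pow \<Omega>) \<and> hahn_action \<Omega> x\<^sub>0 u v = linear_extension f v"
  proof (induction rule: span_of_induct)
    case zero
    then show ?case
      using M(2)[of 0 _ 0] by (simp add: hahn_action_def span_of_closed clinear_zero[OF L])
  next
    case (basis x)
    then show ?case by (auto simp: assms nsets_def intro: span_of_closed)
  qed (simp_all add: hahn_action_def span_of_closed M clinear_add[OF L] clinear_scaleC[OF L])
  then show "hahn_action \<Omega> x\<^sub>0 u v = linear_extension f v" ..
qed

lemma johnson_adjacency_eq_hahn_rep: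
  "johnson_adjacency \<Omega> k = hahn_rep \<Omega> k x\<^sub>0 (generator GB +
    (- (of_nat (card \<Omega>) / 2 + (of_nat (card \<Omega>) - 2 * of_nat k)\<^sup>2 / 4)) *\<^sub>C 1)"
  unfolding johnson_adjacency_def
proof (rule hahn_rep_eq_linear_extension[symmetric])
  fix x assume x: "x \<in> nsets \<Omega> k"
  then have "basis_vec x \<in> span_of (Pow \<Omega>)" by (auto simp: nsets_def intro: span_of_closed)
  then show "hahn_action \<Omega> x\<^sub>0 (generator GB +
      (- (of_nat (card \<Omega>) / 2 + (of_nat (card \<Omega>) - 2 * of_nat k)\<^sup>2 / 4)) *\<^sub>C 1) (basis_vec x) =
      (\<Sum>y | y \<in> nsets \<Omega> k \<and> card (x \<inter> y) + 1 = k. basis_vec y)"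
    using hahn_action_B[OF x] unfolding hahn_action_def
    by (simp only: algebra_hom_simps[OF algebra_hom_natural_hom(1)] usl2_tensor_action_module[OF fin sub])
      (simp only: scaleC_minus_left add_diff_cancel flip: diff_conv_add_uminus)
qed

text \<open>Both operators are diagonal in the \<open>k\<close>-subsets with eigenvalues affine in
  |x - \<open>x\<^sub>0\<close>|. The conclusion \<open>\<alpha> \<noteq> 0\<close> is what later
  allows solving for \<open>A\<close>.\<close>

lemma johnson_dual_adjacency_eq_hahn_rep:
  assumes "card x\<^sub>0 = k" "0 < k" "k < card \<Omega>"
  obtains \<alpha> \<beta> where "\<alpha> \<noteq> 0"
    "johnson_dual_adjacency \<Omega> k x\<^sub>0 = hahn_rep \<Omega> k x\<^sub>0 (\<alpha> *\<^sub>C generator GA + \<beta> *\<^sub>C 1)"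
proof
  define n l where "n = (of_nat (card \<Omega>) :: complex)" and "l = (of_nat k :: complex)"
  \<comment> \<open>With m = |x - \<open>x\<^sub>0\<close>|, the dual eigenvalue is (n - 1) -
    \<open>\<alpha>\<close> m and that of \<open>A\<close> is n/4 - m; \<open>\<alpha>\<close>
    matches the slopes and \<open>\<beta>\<close> the constant terms.\<close>
  define \<alpha> where "\<alpha> = (n - 1) * n / (l * (n - l))"
  define \<beta> where "\<beta> = (n - 1) - \<alpha> * n / 4"
  have "n \<noteq> 1" using assms(2,3) by (auto simp: n_def)
  moreover have nz: "n \<noteq> 0" "l \<noteq> 0" "n - l \<noteq> 0" using assms(2,3) by (auto simp: n_def l_def)
  ultimately show "\<alpha> \<noteq> 0" by (simp add: \<alpha>_def)
  show "johnson_dual_adjacency \<Omega> k x\<^sub>0 = hahn_rep \<Omega> k x\<^sub>0 (\<alpha> *\<^sub>C generator GA + \<beta> *\<^sub>C 1)"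
    unfolding johnson_dual_adjacency_def
  proof (rule hahn_rep_eq_linear_extension[symmetric])
    fix x assume x: "x \<in> nsets \<Omega> k"
    then have x': "finite x" "card x = k" "basis_vec x \<in> span_of (Pow \<Omega>)"
      by (auto simp: nsets_def intro: span_of_closed)
    \<comment> \<open>Two sets of equal size have differences of equal size, so the numerator holds
      2m and its factor 2 cancels the one in the denominator.\<close>
    have "card (x\<^sub>0 - x) = card (x - x\<^sub>0)"
      using x' finite_parts[OF fin sub] assms(1) by (simp add: card_Diff_subset_Int Int_commute)
    then have "of_nat (card \<Omega>) * of_nat (card (x\<^sub>0 - x) + card (x - x\<^sub>0)) /
        (2 * of_nat k * (of_nat (card \<Omega>) - of_nat k)) = n * of_nat (card (x - x\<^sub>0)) / (l * (n - l))"
      by (simp add: n_def l_def flip: mult_2)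
    then have eq: "(of_nat (card \<Omega>) - 1) * (1 - of_nat (card \<Omega>) * of_nat (card (x\<^sub>0 - x) + card (x - x\<^sub>0)) /
        (2 * of_nat k * (of_nat (card \<Omega>) - of_nat k))) = \<alpha> * (n / 4 - of_nat (card (x - x\<^sub>0))) + \<beta>"
      by (simp add: \<beta>_def \<alpha>_def n_def[symmetric] right_diff_distrib)
    show "hahn_action \<Omega> x\<^sub>0 (\<alpha> *\<^sub>C generator GA + \<beta> *\<^sub>C 1) (basis_vec x) =
      ((of_nat (card \<Omega>) - 1) * (1 - of_nat (card \<Omega>) * of_nat (card (x\<^sub>0 - x) + card (x - x\<^sub>0)) /
            (2 * of_nat k * (of_nat (card \<Omega>) - of_nat k)))) *\<^sub>C basis_vec x"
      unfolding eq
      using hahn_action_A[OF x assms(1)] x'(3) unfolding hahn_action_def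
      by (simp add: algebra_hom_simps[OF algebra_hom_natural_hom(1)] scaleC_add_left
          usl2_tensor_action_module[OF fin sub] n_def)
  qed
qed

end

section \<open>Equality of the Terwilliger algebra and the image\<close>

theorem theorem5p9:
  fixes \<Omega> x\<^sub>0 :: "'a set" and D k :: nat
  assumes "finite \<Omega>" and "card \<Omega> = D" and "D \<ge> 2"
    and "1 \<le> k" and "k \<le> D - 1"
    and "x\<^sub>0 \<in> nsets \<Omega> k"
  shows "terwilliger_algebra \<Omega> k x\<^sub>0 = range (hahn_rep \<Omega> k x\<^sub>0)"
proof -
  have x0: "x\<^sub>0 \<subseteq> \<Omega>" "card x\<^sub>0 = k" using assms(6) by (auto simp: nsets_def)
  have k: "0 < k" "k < card \<Omega>" using assms(2-5) by auto
  let ?T = "terwilliger_algebra \<Omega> k x\<^sub>0" and ?\<rho> = "hahn_rep \<Omega> k x\<^sub>0"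
  note rep = hahn_rep_representation[OF assms(1) x0(1)]
  obtain \<alpha> \<beta> where \<alpha>: "\<alpha> \<noteq> 0"
    and dual: "johnson_dual_adjacency \<Omega> k x\<^sub>0 = ?\<rho> (\<alpha> *\<^sub>C generator GA + \<beta> *\<^sub>C 1)"
    using johnson_dual_adjacency_eq_hahn_rep[OF assms(1) x0 k] .
  obtain \<gamma> where adj: "johnson_adjacency \<Omega> k = ?\<rho> (generator GB + \<gamma> *\<^sub>C 1)"
    using johnson_adjacency_eq_hahn_rep[OF assms(1) x0(1)] by blast
  \<comment> \<open>The next facts say that the preimage of \<open>?T\<close> under
    \<open>?\<rho>\<close> is a subalgebra of the Hahn algebra: each operation there becomes a
    closure rule of \<open>generated_subalgebra\<close>.\<close>
  have one: "?\<rho> 1 \<in> ?T"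
    unfolding rep terwilliger_algebra_def by (rule subalg_one)
  have add: "?\<rho> (s + t) \<in> ?T" if "?\<rho> s \<in> ?T" "?\<rho> t \<in> ?T" for s t
    using that unfolding rep terwilliger_algebra_def by (rule subalg_add)
  have scale: "?\<rho> (c *\<^sub>C s) \<in> ?T" if "?\<rho> s \<in> ?T" for c s
    using that unfolding rep terwilliger_algebra_def by (rule subalg_scale)
  have mult: "?\<rho> (s * t) \<in> ?T" if "?\<rho> s \<in> ?T" "?\<rho> t \<in> ?T" for s t
    using that unfolding rep terwilliger_algebra_def by (rule subalg_mult)
  have diff: "?\<rho> (s - t) \<in> ?T" if "?\<rho> s \<in> ?T" "?\<rho> t \<in> ?T" for s t
    using add[OF that(1) scale[OF that(2), of "-1"]] by (simp add: scaleC_minus_left)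
  have "?\<rho> (\<alpha> *\<^sub>C generator GA + \<beta> *\<^sub>C 1) \<in> ?T" "?\<rho> (generator GB + \<gamma> *\<^sub>C 1) \<in> ?T"
    unfolding terwilliger_algebra_def dual[symmetric] adj[symmetric]
    by (rule subalg_base, simp)+
  \<comment> \<open>The two affine expressions are solved for \<open>A\<close> and \<open>B\<close>
    inside the preimage.\<close>
  then have "?\<rho> ((1/\<alpha>) *\<^sub>C (\<alpha> *\<^sub>C generator GA + \<beta> *\<^sub>C 1 - \<beta> *\<^sub>C 1)) \<in> ?T"
    "?\<rho> (generator GB + \<gamma> *\<^sub>C 1 - \<gamma> *\<^sub>C 1) \<in> ?T"
    by (blast intro: diff scale one)+
  then have A: "?\<rho> (generator GA) \<in> ?T" and B: "?\<rho> (generator GB) \<in> ?T"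
    using \<alpha> by simp_all
  have "?\<rho> u \<in> ?T" for u
  proof (induction u rule: presented_induct)
    case (gen g)
    then show ?case by (cases g) (simp_all add: A B diff mult hahn_generator_C)
  qed (simp_all add: one add scale mult)
  \<comment> \<open>Conversely, the range contains both adjacency operators, and each closure rule
    is read backwards as \<open>?\<rho>\<close> of the corresponding operation.\<close>
  moreover have "f \<in> range ?\<rho>" if "f \<in> ?T" for f
    using that unfolding terwilliger_algebra_def
    by (induction rule: generated_subalgebra.induct) (auto simp: dual adj simp del: restrict_apply simp flip: rep(2-5))
  ultimately show ?thesis by blast
qed

end
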